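(* Let $(N,g)$ be a complete finite-dimensional Riemannian manifold, let $M\subset N$ be a submanifold of dimension $n$, with second fundamental form $h$ and mean curvature vector field $H$, and let $x\in M$. If the bilinear form $$\Omega_x:T_xM\times T_xM\to\mathbb{R},\qquad \Omega_x(X,Y)=g(h(X,Y),H_x),$$ is positive definite, then $M$ is strictly $H$-convex at the point $x$.
   Context: Submanifolds are embedded, of dimension $n\ge 1$, and carry the induced metric, also denoted $g$. The second fundamental form $h$ of $M$ takes values in the normal bundle of $M$ in $N$, and the mean curvature vector is $H_x=\frac1n\sum_{i=1}^n h(e_i,e_i)$ for any orthonormal basis $\{e_1,\dots,e_n\}$ of $T_xM$. Definition of (strict) $H$-convexity. Let $x\in M$ with $H_x\neq 0$, and let $V$ be a neighborhood of $x$ in $N$ on which $\exp_x^{-1}$ is defined, i.e. $\exp_x$ restricts to a diffeomorphism from an open neighborhood of $0\in T_xN$ onto $V$. Define $F:V\to\mathbb{R}$ by $F(y)=g_x(H_x,\exp_x^{-1}(y))$ and put $$TGH_x=\{y\in V:F(y)=0\},\quad TGH_x^-=\{y\in V: F(y)\le 0\},\quad TGH_x^+=\{y\in V: F(y)\ge 0\}.$$ $M$ is called $H$-convex at $x$ if $H_x\ne 0$ and there is an open set $U\subset V$ containing $x$ such that $M\cap U$ is contained either in $TGH_x^-$ or in $TGH_x^+$. It is called strictly $H$-convex at $x$ if moreover, for such a $U$, $M\cap U\cap TGH_x=\{x\}$. *)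

theory Defs
  imports "HOL-Analysis.Analysis"
begin

section \<open>Smooth maps on open subsets of normed spaces\<close>

text \<open>All sets \<open>S\<close> below are open in the applications, where this is the usual
  notion of a \<open>C\<^sup>k\<close> map (in finite dimension).\<close>

primrec Ck_on :: "nat \<Rightarrow> 'a::real_normed_vector set \<Rightarrow> ('a \<Rightarrow> 'b::real_normed_vector) \<Rightarrow> bool" where
  "Ck_on 0 S f \<longleftrightarrow> continuous_on S f"
| "Ck_on (Suc k) S f \<longleftrightarrow>
     (\<forall>x\<in>S. f differentiable (at x)) \<and> (\<forall>v. Ck_on k S (\<lambda>x. frechet_derivative f (at x) v))"

definition smooth_on :: "'a::real_normed_vector set \<Rightarrow> ('a \<Rightarrow> 'b::real_normed_vector) \<Rightarrow> bool" where
  "smooth_on S f \<longleftrightarrow> (\<forall>k. Ck_on k S f)"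

section \<open>Smooth manifolds\<close>

text \<open>A chart is a pair of its domain and the coordinate map, whose values off the domain
  are irrelevant. A manifold is a Hausdorff second countable space (a type \<open>'p\<close>) with
  a maximal smooth atlas \<open>N\<close>, modelled on a Euclidean space \<open>'e\<close>.\<close>

type_synonym ('p, 'e) chart = "'p set \<times> ('p \<Rightarrow> 'e)"

abbreviation dom_chart :: "('p, 'e) chart \<Rightarrow> 'p set" where
  "dom_chart c \<equiv> fst c"

abbreviation coords :: "('p, 'e) chart \<Rightarrow> 'p \<Rightarrow> 'e" where
  "coords c \<equiv> snd c"

definition point :: "('p, 'e) chart \<Rightarrow> 'e \<Rightarrow> 'p" where
  "point c = inv_into (dom_chart c) (coords c)"

definition is_chart :: "('p::topological_space, 'e::euclidean_space) chart \<Rightarrow> bool" where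
  "is_chart c \<longleftrightarrow> open (dom_chart c) \<and> open (coords c ` dom_chart c) \<and>
     homeomorphism (dom_chart c) (coords c ` dom_chart c) (coords c) (point c)"

definition smoothly_compatible :: "('p, 'e::euclidean_space) chart \<Rightarrow> ('p, 'e) chart \<Rightarrow> bool" where
  "smoothly_compatible c d \<longleftrightarrow>
     smooth_on (coords c ` (dom_chart c \<inter> dom_chart d)) (coords d \<circ> point c) \<and>
     smooth_on (coords d ` (dom_chart c \<inter> dom_chart d)) (coords c \<circ> point d)"

definition smooth_manifold ::
    "('p::{t2_space, second_countable_topology}, 'e::euclidean_space) chart set \<Rightarrow> bool" where
  "smooth_manifold N \<longleftrightarrow>
     (\<forall>c\<in>N. is_chart c) \<and>
     (\<Union>c\<in>N. dom_chart c) = UNIV \<and>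
     (\<forall>c\<in>N. \<forall>d\<in>N. smoothly_compatible c d) \<and>
     (\<forall>c. is_chart c \<and> (\<forall>d\<in>N. smoothly_compatible c d) \<longrightarrow> c \<in> N)"

definition smooth_into ::
    "('p::topological_space, 'e::euclidean_space) chart set \<Rightarrow> 'a::real_normed_vector set \<Rightarrow> ('a \<Rightarrow> 'p) \<Rightarrow> bool"
  where
  "smooth_into N D f \<longleftrightarrow>
     continuous_on D f \<and> (\<forall>c\<in>N. smooth_on (D \<inter> f -` dom_chart c) (coords c \<circ> f))"

definition smooth_from ::
    "('p, 'e::euclidean_space) chart set \<Rightarrow> 'p set \<Rightarrow> ('p \<Rightarrow> 'b::real_normed_vector) \<Rightarrow> bool" where
  "smooth_from N V f \<longleftrightarrow> (\<forall>c\<in>N. smooth_on (coords c ` (V \<inter> dom_chart c)) (f \<circ> point c))"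

section \<open>Tangent vectors, vector fields, Riemannian metrics\<close>

text \<open>Every tangent space \<open>T\<^sub>pN\<close> is identified with \<open>'e\<close> through one chosen chart
  \<open>chart_at N p\<close> around \<open>p\<close>: the vector \<open>v :: 'e\<close> stands for the tangent vector at \<open>p\<close>
  whose components in that chart are \<open>v\<close>. Its components in another chart \<open>c\<close> are obtained
  with the differential of the coordinate change. In particular a vector field is a
  function \<open>'p \<Rightarrow> 'e\<close>, and a metric is a function \<open>'p \<Rightarrow> 'e \<Rightarrow> 'e \<Rightarrow> real\<close>, whose smoothness
  is that of the components in all charts.\<close>

definition chart_at :: "('p, 'e) chart set \<Rightarrow> 'p \<Rightarrow> ('p, 'e) chart" where
  "chart_at N p = (SOME c. c \<in> N \<and> p \<in> dom_chart c)"

definition coord_change :: "('p, 'e::euclidean_space) chart \<Rightarrow> ('p, 'e) chart \<Rightarrow> 'p \<Rightarrow> 'e \<Rightarrow> 'e" where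
  "coord_change c d p = frechet_derivative (coords d \<circ> point c) (at (coords c p))"

definition field_in_chart ::
    "('p, 'e::euclidean_space) chart set \<Rightarrow> ('p \<Rightarrow> 'e) \<Rightarrow> ('p, 'e) chart \<Rightarrow> 'e \<Rightarrow> 'e" where
  "field_in_chart N Y c y = (let p = point c y in coord_change (chart_at N p) c p (Y p))"

definition smooth_field :: "('p, 'e::euclidean_space) chart set \<Rightarrow> 'p set \<Rightarrow> ('p \<Rightarrow> 'e) \<Rightarrow> bool" where
  "smooth_field N U Y \<longleftrightarrow>
     (\<forall>c\<in>N. smooth_on (coords c ` (U \<inter> dom_chart c)) (field_in_chart N Y c))"

definition velocity ::
    "('p, 'e::euclidean_space) chart set \<Rightarrow> (real \<Rightarrow> 'p) \<Rightarrow> real \<Rightarrow> 'e" where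
  "velocity N \<gamma> t = vector_derivative (coords (chart_at N (\<gamma> t)) \<circ> \<gamma>) (at t)"

definition metric_in_chart ::
    "('p, 'e::euclidean_space) chart set \<Rightarrow> ('p \<Rightarrow> 'e \<Rightarrow> 'e \<Rightarrow> real) \<Rightarrow> ('p, 'e) chart
      \<Rightarrow> 'e \<Rightarrow> 'e \<Rightarrow> 'e \<Rightarrow> real" where
  "metric_in_chart N g c y u v =
     (let p = point c y; T = coord_change c (chart_at N p) p in g p (T u) (T v))"

definition riemannian_manifold ::
    "('p::{t2_space, second_countable_topology}, 'e::euclidean_space) chart set
      \<Rightarrow> ('p \<Rightarrow> 'e \<Rightarrow> 'e \<Rightarrow> real) \<Rightarrow> bool" where
  "riemannian_manifold N g \<longleftrightarrow>
     smooth_manifold N \<and>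
     (\<forall>p. bilinear (g p) \<and> (\<forall>u v. g p u v = g p v u) \<and> (\<forall>u. u \<noteq> 0 \<longrightarrow> g p u u > 0)) \<and>
     (\<forall>c\<in>N. \<forall>u v. smooth_on (coords c ` dom_chart c) (\<lambda>y. metric_in_chart N g c y u v))"

section \<open>Levi-Civita connection, geodesics, exponential map\<close>

text \<open>\<open>christoffel N g c y u v\<close> is \<open>\<Sum>\<^sub>i\<^sub>j\<^sub>k \<Gamma>\<^sup>k\<^sub>i\<^sub>j u\<^sup>i v\<^sup>j \<partial>\<^sub>k\<close>, the Levi-Civita derivative of the
  constant-component field \<open>v\<close> in direction \<open>u\<close>, given by the Koszul formula.\<close>

definition christoffel ::
    "('p, 'e::euclidean_space) chart set \<Rightarrow> ('p \<Rightarrow> 'e \<Rightarrow> 'e \<Rightarrow> real) \<Rightarrow> ('p, 'e) chart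
      \<Rightarrow> 'e \<Rightarrow> 'e \<Rightarrow> 'e \<Rightarrow> 'e" where
  "christoffel N g c y u v =
     (let G = metric_in_chart N g c;
          dG = (\<lambda>a b w. frechet_derivative (\<lambda>y'. G y' a b) (at y) w)
      in THE z. \<forall>w. 2 * G y z w = dG v w u + dG u w v - dG u v w)"

text \<open>\<open>\<nabla>\<^sub>X Y\<close> at \<open>x\<close>, computed in the chart that identifies \<open>T\<^sub>xN\<close> with \<open>'e\<close>.\<close>

definition cov_deriv ::
    "('p, 'e::euclidean_space) chart set \<Rightarrow> ('p \<Rightarrow> 'e \<Rightarrow> 'e \<Rightarrow> real) \<Rightarrow> 'p \<Rightarrow> 'e \<Rightarrow> ('p \<Rightarrow> 'e) \<Rightarrow> 'e" where
  "cov_deriv N g x X Y =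
     (let c = chart_at N x
      in frechet_derivative (field_in_chart N Y c) (at (coords c x)) X
         + christoffel N g c (coords c x) X (Y x))"

definition geodesic ::
    "('p::topological_space, 'e::euclidean_space) chart set \<Rightarrow> ('p \<Rightarrow> 'e \<Rightarrow> 'e \<Rightarrow> real) \<Rightarrow> (real \<Rightarrow> 'p) \<Rightarrow> bool"
  where
  "geodesic N g \<gamma> \<longleftrightarrow>
     smooth_into N UNIV \<gamma> \<and>
     (\<forall>c\<in>N. \<forall>t. \<gamma> t \<in> dom_chart c \<longrightarrow>
       (let v = (\<lambda>s. vector_derivative (coords c \<circ> \<gamma>) (at s))
        in vector_derivative v (at t) + christoffel N g c (coords c (\<gamma> t)) (v t) (v t) = 0))"

text \<open>Geodesic completeness: the geodesic with any given initial data is defined on all of \<open>\<real>\<close>.\<close>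

definition complete_riemannian_manifold ::
    "('p::{t2_space, second_countable_topology}, 'e::euclidean_space) chart set
      \<Rightarrow> ('p \<Rightarrow> 'e \<Rightarrow> 'e \<Rightarrow> real) \<Rightarrow> bool" where
  "complete_riemannian_manifold N g \<longleftrightarrow>
     riemannian_manifold N g \<and>
     (\<forall>x v. \<exists>\<gamma>. geodesic N g \<gamma> \<and> \<gamma> 0 = x \<and> velocity N \<gamma> 0 = v)"

definition riem_exp ::
    "('p::topological_space, 'e::euclidean_space) chart set \<Rightarrow> ('p \<Rightarrow> 'e \<Rightarrow> 'e \<Rightarrow> real) \<Rightarrow> 'p \<Rightarrow> 'e \<Rightarrow> 'p"
  where
  "riem_exp N g x v =
     (THE y. \<exists>\<gamma>. geodesic N g \<gamma> \<and> \<gamma> 0 = x \<and> velocity N \<gamma> 0 = v \<and> \<gamma> 1 = y)"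

section \<open>Submanifolds, second fundamental form, mean curvature\<close>

definition embedded_submanifold ::
    "('p, 'e::euclidean_space) chart set \<Rightarrow> 'p set \<Rightarrow> nat \<Rightarrow> bool" where
  "embedded_submanifold N M n \<longleftrightarrow>
     (\<forall>p\<in>M. \<exists>c\<in>N. p \<in> dom_chart c \<and>
       (\<exists>S. subspace S \<and> dim S = n \<and> coords c ` (M \<inter> dom_chart c) = coords c ` dom_chart c \<inter> S))"

definition tangent_space ::
    "('p::topological_space, 'e::euclidean_space) chart set \<Rightarrow> 'p set \<Rightarrow> 'p \<Rightarrow> 'e set" where
  "tangent_space N M p =
     {velocity N \<gamma> 0 | \<gamma>. \<exists>\<epsilon>>0. smooth_into N {-\<epsilon><..<\<epsilon>} \<gamma> \<and> \<gamma> ` {-\<epsilon><..<\<epsilon>} \<subseteq> M \<and> \<gamma> 0 = p}"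

definition normal_part ::
    "('p::topological_space, 'e::euclidean_space) chart set \<Rightarrow> ('p \<Rightarrow> 'e \<Rightarrow> 'e \<Rightarrow> real) \<Rightarrow> 'p set \<Rightarrow> 'p \<Rightarrow> 'e \<Rightarrow> 'e"
  where
  "normal_part N g M x z =
     (THE w. (\<forall>X\<in>tangent_space N M x. g x w X = 0) \<and> z - w \<in> tangent_space N M x)"

text \<open>\<open>h(X,Y)\<close> is the normal part of \<open>\<nabla>\<^sub>X Z\<close>, where \<open>Z\<close> is any smooth field near \<open>x\<close> that is
  tangent to \<open>M\<close> along \<open>M\<close> and extends \<open>Y\<close>; the result does not depend on the choice of \<open>Z\<close>.\<close>

definition second_fundamental_form ::
    "('p::topological_space, 'e::euclidean_space) chart set \<Rightarrow> ('p \<Rightarrow> 'e \<Rightarrow> 'e \<Rightarrow> real) \<Rightarrow> 'p set \<Rightarrow> 'p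
      \<Rightarrow> 'e \<Rightarrow> 'e \<Rightarrow> 'e" where
  "second_fundamental_form N g M x X Y =
     normal_part N g M x (cov_deriv N g x X
       (SOME Z. \<exists>U. open U \<and> x \<in> U \<and> smooth_field N U Z \<and>
          (\<forall>p\<in>M \<inter> U. Z p \<in> tangent_space N M p) \<and> Z x = Y))"

definition orthonormal_basis ::
    "('e \<Rightarrow> 'e \<Rightarrow> real) \<Rightarrow> 'e::euclidean_space set \<Rightarrow> 'e set \<Rightarrow> bool" where
  "orthonormal_basis b T B \<longleftrightarrow>
     finite B \<and> span B = T \<and> (\<forall>u\<in>B. \<forall>v\<in>B. b u v = (if u = v then 1 else 0))"

text \<open>Again independent of the choice of the basis \<open>B\<close>; the dimension of \<open>M\<close> is that of \<open>T\<^sub>xM\<close>.\<close>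

definition mean_curvature ::
    "('p::topological_space, 'e::euclidean_space) chart set \<Rightarrow> ('p \<Rightarrow> 'e \<Rightarrow> 'e \<Rightarrow> real) \<Rightarrow> 'p set \<Rightarrow> 'p \<Rightarrow> 'e"
  where
  "mean_curvature N g M x =
     (let T = tangent_space N M x; B = (SOME B. orthonormal_basis (g x) T B)
      in (1 / real (dim T)) *\<^sub>R (\<Sum>e\<in>B. second_fundamental_form N g M x e e))"

definition Omega ::
    "('p::topological_space, 'e::euclidean_space) chart set \<Rightarrow> ('p \<Rightarrow> 'e \<Rightarrow> 'e \<Rightarrow> real) \<Rightarrow> 'p set \<Rightarrow> 'p
      \<Rightarrow> 'e \<Rightarrow> 'e \<Rightarrow> real" where
  "Omega N g M x X Y = g x (second_fundamental_form N g M x X Y) (mean_curvature N g M x)"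

section \<open>H-convexity\<close>

text \<open>\<open>exp\<^sub>x\<close> restricts to a diffeomorphism of the open neighbourhood \<open>D\<close> of 0 in \<open>T\<^sub>xN\<close> onto the
  neighbourhood \<open>V\<close> of \<open>x\<close>. The branch of \<open>exp\<^sub>x\<^sup>-\<^sup>1\<close> on \<open>V\<close> is determined by \<open>D\<close>, which is why
  both sets are arguments below.\<close>

definition exp_diffeo ::
    "('p::topological_space, 'e::euclidean_space) chart set \<Rightarrow> ('p \<Rightarrow> 'e \<Rightarrow> 'e \<Rightarrow> real) \<Rightarrow> 'p
      \<Rightarrow> 'e set \<Rightarrow> 'p set \<Rightarrow> bool" where
  "exp_diffeo N g x D V \<longleftrightarrow>
     open D \<and> 0 \<in> D \<and> open V \<and> x \<in> V \<and> bij_betw (riem_exp N g x) D V \<and>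
     smooth_into N D (riem_exp N g x) \<and> smooth_from N V (inv_into D (riem_exp N g x))"

definition TGH_fun ::
    "('p::topological_space, 'e::euclidean_space) chart set \<Rightarrow> ('p \<Rightarrow> 'e \<Rightarrow> 'e \<Rightarrow> real) \<Rightarrow> 'p set \<Rightarrow> 'p
      \<Rightarrow> 'e set \<Rightarrow> 'p \<Rightarrow> real" where
  "TGH_fun N g M x D y = g x (mean_curvature N g M x) (inv_into D (riem_exp N g x) y)"

definition TGH ::
    "('p::topological_space, 'e::euclidean_space) chart set \<Rightarrow> ('p \<Rightarrow> 'e \<Rightarrow> 'e \<Rightarrow> real) \<Rightarrow> 'p set \<Rightarrow> 'p
      \<Rightarrow> 'e set \<Rightarrow> 'p set \<Rightarrow> 'p set" where
  "TGH N g M x D V = {y \<in> V. TGH_fun N g M x D y = 0}"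

definition TGH_minus ::
    "('p::topological_space, 'e::euclidean_space) chart set \<Rightarrow> ('p \<Rightarrow> 'e \<Rightarrow> 'e \<Rightarrow> real) \<Rightarrow> 'p set \<Rightarrow> 'p
      \<Rightarrow> 'e set \<Rightarrow> 'p set \<Rightarrow> 'p set" where
  "TGH_minus N g M x D V = {y \<in> V. TGH_fun N g M x D y \<le> 0}"

definition TGH_plus ::
    "('p::topological_space, 'e::euclidean_space) chart set \<Rightarrow> ('p \<Rightarrow> 'e \<Rightarrow> 'e \<Rightarrow> real) \<Rightarrow> 'p set \<Rightarrow> 'p
      \<Rightarrow> 'e set \<Rightarrow> 'p set \<Rightarrow> 'p set" where
  "TGH_plus N g M x D V = {y \<in> V. TGH_fun N g M x D y \<ge> 0}"

definition H_convex_witness ::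
    "('p::topological_space, 'e::euclidean_space) chart set \<Rightarrow> ('p \<Rightarrow> 'e \<Rightarrow> 'e \<Rightarrow> real) \<Rightarrow> 'p set \<Rightarrow> 'p
      \<Rightarrow> 'e set \<Rightarrow> 'p set \<Rightarrow> 'p set \<Rightarrow> bool" where
  "H_convex_witness N g M x D V U \<longleftrightarrow>
     open U \<and> x \<in> U \<and> U \<subseteq> V \<and>
     (M \<inter> U \<subseteq> TGH_minus N g M x D V \<or> M \<inter> U \<subseteq> TGH_plus N g M x D V)"

definition H_convex_at ::
    "('p::topological_space, 'e::euclidean_space) chart set \<Rightarrow> ('p \<Rightarrow> 'e \<Rightarrow> 'e \<Rightarrow> real) \<Rightarrow> 'p set \<Rightarrow> 'p
      \<Rightarrow> 'e set \<Rightarrow> 'p set \<Rightarrow> bool" where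
  "H_convex_at N g M x D V \<longleftrightarrow>
     mean_curvature N g M x \<noteq> 0 \<and> (\<exists>U. H_convex_witness N g M x D V U)"

definition strictly_H_convex_at ::
    "('p::topological_space, 'e::euclidean_space) chart set \<Rightarrow> ('p \<Rightarrow> 'e \<Rightarrow> 'e \<Rightarrow> real) \<Rightarrow> 'p set \<Rightarrow> 'p
      \<Rightarrow> 'e set \<Rightarrow> 'p set \<Rightarrow> bool" where
  "strictly_H_convex_at N g M x D V \<longleftrightarrow>
     mean_curvature N g M x \<noteq> 0 \<and>
     (\<exists>U. H_convex_witness N g M x D V U \<and> M \<inter> U \<inter> TGH N g M x D V = {x})"

end

theory Submission
  imports Defs
begin

text \<open>Fix the chart \<open>cx\<close> at \<open>x\<close> that identifies \<open>T\<^sub>xN\<close> with the model space, put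
  \<open>L = g\<^sub>x(H\<^sub>x, _)\<close>, and look at \<open>F = L \<circ> exp\<^sub>x\<^sup>-\<^sup>1\<close>, the function whose sign decides on which side
  of \<open>TGH\<^sub>x\<close> a point lies. Along the geodesic \<open>\<gamma>\<close> with initial velocity \<open>v\<close> one has
  \<open>F(\<gamma>(t)) = t L(v)\<close>. Differentiating this once and twice at \<open>t = 0\<close> and inserting the geodesic
  equation \<open>\<gamma>'' = - \<Gamma>(\<gamma>',\<gamma>')\<close> gives the 2-jet of \<open>F\<close> in the chart:
  \<open>dF(v) = L(v)\<close> and \<open>d\<^sup>2F(v,v) = L(\<Gamma>(v,v))\<close> (lemma \<open>dderiv_linear_log\<close>). As the
  inverse map is known explicitly along each geodesic, this takes the place of an expansion of \<open>exp\<^sub>x\<close>.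

  Near \<open>x\<close> the submanifold \<open>M\<close> is a linear subspace \<open>S\<close> in a slice chart \<open>d\<close>. Let \<open>\<tau>\<close> be the
  coordinate change from \<open>d\<close> to \<open>cx\<close>. For \<open>s \<in> S\<close> the straight line in direction \<open>s\<close> is a curve
  in \<open>M\<close>, with velocity \<open>X = d\<tau>(s)\<close> at \<open>x\<close>, and the second derivative of \<open>F\<close> along it is \<open>L\<close> applied to
  the covariant acceleration \<open>A = d\<^sup>2\<tau>(s,s) + \<Gamma>(X,X)\<close> (lemma \<open>dderiv_linear_log_slice\<close>). On the
  other hand, \<open>\<nabla>\<^sub>XZ\<close> differs from \<open>A\<close> by a tangent vector for every field \<open>Z\<close> tangent to \<open>M\<close> that
  extends \<open>X\<close> (lemma \<open>cov_deriv_tangent_field\<close>), so \<open>h(X,X)\<close> is the normal part of \<open>A\<close>. As \<open>H\<^sub>x\<close>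
  is normal, \<open>L(A) = \<Omega>\<^sub>x(X,X)\<close> (lemma \<open>Omega_eq\<close>). Hence \<open>F\<close> restricted to \<open>M\<close> has at \<open>x\<close> the
  value \<open>0\<close>, the differential \<open>L\<close> restricted to \<open>T\<^sub>xM\<close>, which is \<open>0\<close>, and the positive definite
  Hessian \<open>\<Omega>\<^sub>x\<close>; so \<open>F > 0\<close> on \<open>M\<close> near \<open>x\<close> except at \<open>x\<close> itself.

  The identity \<open>F(\<gamma>(t)) = t L(v)\<close> needs \<open>exp\<^sub>x(tv) = \<gamma>(t)\<close>. The exponential map is defined by a definite
  description over all geodesics, so it has this value only because a geodesic is determined by its
  initial data. This uniqueness is proved from Gronwall's inequality and the local Lipschitz
  continuity of the geodesic spray.\<close>
section \<open>Calculus of smooth maps\<close>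

abbreviation dderiv :: "('a::real_normed_vector \<Rightarrow> 'b::real_normed_vector) \<Rightarrow> 'a \<Rightarrow> 'a \<Rightarrow> 'b" where
  "dderiv f v \<equiv> (\<lambda>x. frechet_derivative f (at x) v)"

lemma linear_dderiv: "f differentiable (at x) \<Longrightarrow> linear (\<lambda>v. dderiv f v x)"
  using linear_frechet_derivative by blast

lemma has_derivative_dderiv:
  "f differentiable (at x) \<Longrightarrow> (f has_derivative (\<lambda>v. dderiv f v x)) (at x)"
  by (simp add: frechet_derivative_works)

lemma dderiv_eqI: "(f has_derivative f') (at x) \<Longrightarrow> dderiv f v x = f' v"
  using frechet_derivative_at by metis

lemma Ck_on_continuous: "Ck_on k S f \<Longrightarrow> continuous_on S f"
  by (cases k) (auto intro!: continuous_at_imp_continuous_on differentiable_imp_continuous_within)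

lemma Ck_on_Suc_imp: "Ck_on (Suc k) S f \<Longrightarrow> Ck_on k S f"
proof (induction k arbitrary: f)
  case 0
  then show ?case using Ck_on_continuous by fastforce
next
  case (Suc k)
  then show ?case by (meson Ck_on.simps(2))
qed

lemma has_derivative_cong_open:
  assumes "(f has_derivative f') (at x)" "open S" "x \<in> S" "\<And>y. y \<in> S \<Longrightarrow> f y = g y"
  shows "(g has_derivative f') (at x)"
  using has_derivative_transform_within_open[OF assms(1-3)] assms(4) by blast

lemma dderiv_cong_open:
  assumes "open S" "x \<in> S" "\<And>y. y \<in> S \<Longrightarrow> f y = g y"
  shows "dderiv f v x = dderiv g v x"
proof -
  have "(f has_derivative f') (at x) \<longleftrightarrow> (g has_derivative f') (at x)" for f'
    using has_derivative_cong_open[of f f' x S g] has_derivative_cong_open[of g f' x S f] assms by auto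
  then show ?thesis by (simp add: frechet_derivative_def)
qed

lemma Ck_on_cong:
  assumes "open S" "\<And>y. y \<in> S \<Longrightarrow> f y = g y" "Ck_on k S f"
  shows "Ck_on k S g"
  using assms
proof (induction k arbitrary: f g)
  case 0 then show ?case by (metis Ck_on.simps(1) continuous_on_cong)
next
  case (Suc k)
  have "g differentiable (at x)" if "x \<in> S" for x
    using Suc.prems that unfolding differentiable_def by (metis Ck_on.simps(2) differentiable_def has_derivative_cong_open)
  moreover have "Ck_on k S (dderiv g v)" for v
  proof (rule Suc.IH[OF Suc.prems(1)])
    show "Ck_on k S (dderiv f v)" using Suc.prems by simp
    show "dderiv f v y = dderiv g v y" if "y \<in> S" for y
      using dderiv_cong_open[of S y f g v] Suc.prems that by auto
  qed
  ultimately show ?case by simp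
qed

lemma Ck_on_const: "Ck_on k S (\<lambda>x. c)"
  by (induction k arbitrary: c) auto

lemma Ck_on_bounded_linear_comp:
  assumes "open S" "bounded_linear L" "Ck_on k S f"
  shows "Ck_on k S (\<lambda>x. L (f x))"
  using assms(3)
proof (induction k arbitrary: f)
  case 0 then show ?case using assms(2) by (auto intro: bounded_linear.continuous_on)
next
  case (Suc k)
  have d: "((\<lambda>x. L (f x)) has_derivative (\<lambda>v. L (dderiv f v x))) (at x)" if "x \<in> S" for x
    using Suc.prems that by (intro bounded_linear.has_derivative[OF assms(2)] has_derivative_dderiv) auto
  then have "(\<lambda>x. L (f x)) differentiable (at x)" if "x \<in> S" for x
    using that unfolding differentiable_def by blast
  moreover have "Ck_on k S (dderiv (\<lambda>x. L (f x)) v)" for v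
  proof (rule Ck_on_cong[OF assms(1)])
    show "L (dderiv f v y) = dderiv (\<lambda>x. L (f x)) v y" if "y \<in> S" for y
      using dderiv_eqI[OF d] that by metis
    show "Ck_on k S (\<lambda>y. L (dderiv f v y))" using Suc by simp
  qed
  ultimately show ?case by simp
qed

lemma Ck_on_add:
  assumes "open S" "Ck_on k S f" "Ck_on k S g"
  shows "Ck_on k S (\<lambda>x. f x + g x)"
  using assms(2,3)
proof (induction k arbitrary: f g)
  case 0 then show ?case by (auto intro: continuous_on_add)
next
  case (Suc k)
  have d: "((\<lambda>x. f x + g x) has_derivative (\<lambda>v. dderiv f v x + dderiv g v x)) (at x)" if "x \<in> S" for x
    using Suc.prems that by (intro has_derivative_add has_derivative_dderiv) auto
  then have "(\<lambda>x. f x + g x) differentiable (at x)" if "x \<in> S" for x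
    using that unfolding differentiable_def by blast
  moreover have "Ck_on k S (dderiv (\<lambda>x. f x + g x) v)" for v
  proof (rule Ck_on_cong[OF assms(1)])
    show "dderiv f v y + dderiv g v y = dderiv (\<lambda>x. f x + g x) v y" if "y \<in> S" for y
      using dderiv_eqI[OF d] that by metis
    show "Ck_on k S (\<lambda>y. dderiv f v y + dderiv g v y)" using Suc by simp
  qed
  ultimately show ?case by simp
qed

lemma Ck_on_sum:
  assumes "open S" "finite B" "\<And>b. b \<in> B \<Longrightarrow> Ck_on k S (f b)"
  shows "Ck_on k S (\<lambda>x. \<Sum>b\<in>B. f b x)"
  using assms(2,3)
  by (induction B rule: finite_induct) (auto intro: Ck_on_const Ck_on_add[OF assms(1)])

text \<open>The Leibniz rule expresses a directional derivative of the product through products of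
  functions that are again \<open>C\<^sup>k\<close>; lowering the order of the undifferentiated factor needs
  \<open>Ck_on_Suc_imp\<close>.\<close>
lemma Ck_on_scaleR:
  assumes "open S" "Ck_on k S f" "Ck_on k S g"
  shows "Ck_on k S (\<lambda>x. f x *\<^sub>R g x)"
  using assms(2,3)
proof (induction k arbitrary: f g)
  case 0 then show ?case by (auto intro: continuous_on_scaleR)
next
  case (Suc k)
  have d: "((\<lambda>x. f x *\<^sub>R g x) has_derivative (\<lambda>v. f x *\<^sub>R dderiv g v x + dderiv f v x *\<^sub>R g x)) (at x)"
    if "x \<in> S" for x
    using Suc.prems that by (intro has_derivative_scaleR has_derivative_dderiv) auto
  then have "(\<lambda>x. f x *\<^sub>R g x) differentiable (at x)" if "x \<in> S" for x
    using that unfolding differentiable_def by blast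
  moreover have "Ck_on k S (dderiv (\<lambda>x. f x *\<^sub>R g x) v)" for v
  proof (rule Ck_on_cong[OF assms(1)])
    show "f y *\<^sub>R dderiv g v y + dderiv f v y *\<^sub>R g y = dderiv (\<lambda>x. f x *\<^sub>R g x) v y" if "y \<in> S" for y
      using dderiv_eqI[OF d] that by metis
    show "Ck_on k S (\<lambda>y. f y *\<^sub>R dderiv g v y + dderiv f v y *\<^sub>R g y)"
      using Suc.prems Ck_on_Suc_imp[OF Suc.prems(1)] Ck_on_Suc_imp[OF Suc.prems(2)]
      by (intro Ck_on_add[OF assms(1)] Suc.IH) auto
  qed
  ultimately show ?case by simp
qed

lemma linear_Basis_sum:
  fixes L :: "'a::euclidean_space \<Rightarrow> 'b::real_normed_vector"
  assumes "linear L"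
  shows "L v = (\<Sum>b\<in>Basis. (v \<bullet> b) *\<^sub>R L b)"
proof -
  have "L v = L (\<Sum>b\<in>Basis. (v \<bullet> b) *\<^sub>R b)" by (simp add: euclidean_representation)
  then show ?thesis using assms by (simp add: linear_sum linear_scale)
qed

text \<open>The chain rule gives \<open>D(g \<circ> f)(x)v = Dg(f x)(Df(x)v)\<close>, where the direction of differentiation
  of \<open>g\<close> depends on \<open>x\<close>. Expanding it in the standard basis leaves only derivatives of \<open>g\<close> in fixed
  directions, to which the induction hypothesis applies.\<close>
lemma Ck_on_compose:
  fixes f :: "'a::real_normed_vector \<Rightarrow> 'b::euclidean_space"
    and g :: "'b \<Rightarrow> 'c::real_normed_vector"
  assumes "open S" "f ` S \<subseteq> T" "Ck_on k S f" "Ck_on k T g"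
  shows "Ck_on k S (\<lambda>x. g (f x))"
  using assms(3,4)
proof (induction k arbitrary: g)
  case 0 then show ?case using assms(2) by (auto intro: continuous_on_compose2)
next
  case (Suc k)
  have gd: "g differentiable (at (f x))" if "x \<in> S" for x using Suc.prems assms(2) that by auto
  have d: "((\<lambda>x. g (f x)) has_derivative (\<lambda>v. dderiv g (dderiv f v x) (f x))) (at x)" if "x \<in> S" for x
  proof -
    have "(f has_derivative (\<lambda>v. dderiv f v x)) (at x)"
      using Suc.prems that by (intro has_derivative_dderiv) auto
    moreover have "(g has_derivative (\<lambda>v. dderiv g v (f x))) (at (f x))"
      using gd that by (intro has_derivative_dderiv)
    ultimately show ?thesis by (rule has_derivative_compose)
  qed
  then have "(\<lambda>x. g (f x)) differentiable (at x)" if "x \<in> S" for x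
    using that unfolding differentiable_def by blast
  moreover have "Ck_on k S (dderiv (\<lambda>x. g (f x)) v)" for v
  proof (rule Ck_on_cong[OF assms(1)])
    show "(\<Sum>b\<in>Basis. (dderiv f v y \<bullet> b) *\<^sub>R dderiv g b (f y)) = dderiv (\<lambda>x. g (f x)) v y" if "y \<in> S" for y
      unfolding dderiv_eqI[OF d[OF that]]
      by (rule linear_Basis_sum[OF linear_dderiv[OF gd[OF that]], symmetric])
    show "Ck_on k S (\<lambda>y. \<Sum>b\<in>Basis. (dderiv f v y \<bullet> b) *\<^sub>R dderiv g b (f y))"
    proof (intro Ck_on_sum[OF assms(1)] Ck_on_scaleR[OF assms(1)] finite_Basis)
      fix b :: 'b
      show "Ck_on k S (\<lambda>y. dderiv f v y \<bullet> b)"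
        using Suc.prems by (intro Ck_on_bounded_linear_comp[OF assms(1) bounded_linear_inner_left]) auto
      show "Ck_on k S (\<lambda>y. dderiv g b (f y))"
        using Suc.prems Ck_on_Suc_imp[OF Suc.prems(1)] by (intro Suc.IH) auto
    qed
  qed
  ultimately show ?case by simp
qed

lemma Ck_on_bounded_linear: "bounded_linear L \<Longrightarrow> Ck_on k S L"
proof (cases k)
  case (Suc j)
  assume L: "bounded_linear L"
  then have "dderiv L v = (\<lambda>x. L v)" for v
    using dderiv_eqI[OF bounded_linear_imp_has_derivative[OF L]] by blast
  then show ?thesis using L Suc by (auto simp: Ck_on_const bounded_linear_imp_differentiable)
qed (auto simp: linear_continuous_on)

lemma smooth_onD: 
  assumes "smooth_on S f"
  shows "x \<in> S \<Longrightarrow> f differentiable (at x)" "smooth_on S (dderiv f v)" "continuous_on S f"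
  using assms[unfolded smooth_on_def, rule_format, of 1] assms[unfolded smooth_on_def, rule_format, of "Suc _"]
    assms[unfolded smooth_on_def, rule_format, of 0]
  by (auto simp: smooth_on_def)

lemma smooth_on_has_derivative:
  "smooth_on S f \<Longrightarrow> x \<in> S \<Longrightarrow> (f has_derivative (\<lambda>v. dderiv f v x)) (at x)"
  by (intro has_derivative_dderiv smooth_onD(1))

lemma smooth_on_cong:
  "open S \<Longrightarrow> (\<And>y. y \<in> S \<Longrightarrow> f y = g y) \<Longrightarrow> smooth_on S f \<Longrightarrow> smooth_on S g"
  unfolding smooth_on_def using Ck_on_cong[of S f g] by simp

lemma smooth_on_compose:
  fixes f :: "'a::real_normed_vector \<Rightarrow> 'b::euclidean_space"
    and g :: "'b \<Rightarrow> 'c::real_normed_vector"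
  shows "open S \<Longrightarrow> f ` S \<subseteq> T \<Longrightarrow> smooth_on S f \<Longrightarrow> smooth_on T g \<Longrightarrow> smooth_on S (\<lambda>x. g (f x))"
  unfolding smooth_on_def by (intro allI, rule Ck_on_compose[of S f T]) auto

lemma smooth_on_bounded_linear_comp:
  "open S \<Longrightarrow> bounded_linear L \<Longrightarrow> smooth_on S f \<Longrightarrow> smooth_on S (\<lambda>x. L (f x))"
  by (auto simp: smooth_on_def intro: Ck_on_bounded_linear_comp)

lemma smooth_on_affine:
  "open S \<Longrightarrow> bounded_linear L \<Longrightarrow> smooth_on S (\<lambda>x. a + L x)"
  unfolding smooth_on_def by (intro allI Ck_on_add Ck_on_const Ck_on_bounded_linear)

lemma continuous_at_eventually_in:
  assumes "isCont y t" "open S" "y t \<in> S"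
  shows "\<forall>\<^sub>F s in nhds t. y s \<in> S"
proof -
  have "(y \<longlongrightarrow> y t) (nhds t)"
    using assms(1) by (simp add: isCont_def tendsto_at_iff_tendsto_nhds)
  then show ?thesis using assms(2,3) by (rule topological_tendstoD)
qed

lemma has_vector_derivative_eventually_eq:
  assumes "(f has_vector_derivative f') (at t)" "\<forall>\<^sub>F s in nhds t. f s = g s"
  shows "(g has_vector_derivative f') (at t)"
  using has_vector_derivative_cong_ev[where S=UNIV and x=t and f=f and g=g] eventually_nhds_x_imp_x[OF assms(2)] assms
  by simp

lemma smooth_curve_vector_derivative:
  fixes u :: "real \<Rightarrow> 'b::euclidean_space"
  assumes "smooth_on I u" "t \<in> I"
  shows "(u has_vector_derivative dderiv u 1 t) (at t)" "vector_derivative u (at t) = dderiv u 1 t"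
proof -
  have "u differentiable (at t)" using assms smooth_onD by blast
  then show "(u has_vector_derivative dderiv u 1 t) (at t)"
    by (simp add: frechet_derivative_eq_vector_derivative vector_derivative_works differentiableI_vector)
  then show "vector_derivative u (at t) = dderiv u 1 t" using vector_derivative_at by blast
qed

lemma has_vector_derivative_along_curve:
  assumes "(f has_derivative f') (at (u t))" "(u has_vector_derivative u') (at t)"
  shows "((\<lambda>s. f (u s)) has_vector_derivative f' u') (at t)"
  using vector_derivative_diff_chain_within[of u u' t UNIV f f'] assms
  by (auto simp: o_def intro: has_derivative_at_withinI)

text \<open>Linearity of the second derivative in its first direction \<open>w\<close>: near \<open>y\<close> the function
  \<open>dderiv f w\<close> is the combination of the partial derivatives with the coefficients of \<open>w\<close>.\<close>
lemma dderiv_dderiv_linear: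
  fixes f :: "'a::euclidean_space \<Rightarrow> 'b::real_normed_vector"
  assumes "open S" "smooth_on S f" "y \<in> S"
  shows "dderiv (dderiv f w) h y = (\<Sum>b\<in>Basis. (w \<bullet> b) *\<^sub>R dderiv (dderiv f b) h y)"
proof -
  have "((\<lambda>x. \<Sum>b\<in>Basis. (w \<bullet> b) *\<^sub>R dderiv f b x) has_derivative
         (\<lambda>h. \<Sum>b\<in>Basis. (w \<bullet> b) *\<^sub>R dderiv (dderiv f b) h y)) (at y)"
    by (intro has_derivative_sum has_derivative_scaleR_right
        smooth_on_has_derivative[OF _ assms(3)] smooth_onD[OF assms(2)])
  then have "(dderiv f w has_derivative
         (\<lambda>h. \<Sum>b\<in>Basis. (w \<bullet> b) *\<^sub>R dderiv (dderiv f b) h y)) (at y)"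
  proof (rule has_derivative_cong_open[OF _ assms(1,3)])
    fix x assume "x \<in> S"
    then show "(\<Sum>b\<in>Basis. (w \<bullet> b) *\<^sub>R dderiv f b x) = dderiv f w x"
      using linear_Basis_sum[OF linear_dderiv[OF smooth_onD(1)[OF assms(2)]], of x w] by simp
  qed
  then show ?thesis by (rule dderiv_eqI)
qed

text \<open>The one second-order chain rule behind the whole proof. It is applied to curves \<open>y\<close> with their own
  velocity \<open>w = y'\<close>, to lines mapped through a coordinate change, and to tangent fields along curves.\<close>
lemma has_vector_derivative_dderiv_along:
  fixes f :: "'a::euclidean_space \<Rightarrow> 'b::real_normed_vector"
  assumes "open S" "smooth_on S f" "y t \<in> S"
    and y: "(y has_vector_derivative y') (at t)" and w: "(w has_vector_derivative w') (at t)"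
  shows "((\<lambda>s. dderiv f (w s) (y s)) has_vector_derivative
           dderiv (dderiv f (w t)) y' (y t) + dderiv f w' (y t)) (at t)"
proof -
  have 1: "((\<lambda>s. dderiv f b (y s)) has_vector_derivative dderiv (dderiv f b) y' (y t)) (at t)" for b
    using has_vector_derivative_along_curve[OF smooth_on_has_derivative[OF smooth_onD(2)[OF assms(2)] assms(3)] y] .
  have 2: "((\<lambda>s. w s \<bullet> b) has_vector_derivative w' \<bullet> b) (at t)" for b
    using bounded_linear.has_vector_derivative[OF bounded_linear_inner_left w] .
  have "((\<lambda>s. \<Sum>b\<in>Basis. (w s \<bullet> b) *\<^sub>R dderiv f b (y s)) has_vector_derivative
     (\<Sum>b\<in>Basis. (w t \<bullet> b) *\<^sub>R dderiv (dderiv f b) y' (y t) + (w' \<bullet> b) *\<^sub>R dderiv f b (y t))) (at t)"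
    by (intro has_vector_derivative_sum has_vector_derivative_scaleR 1
        2[unfolded has_real_derivative_iff_has_vector_derivative[symmetric]])
  moreover have "(\<Sum>b\<in>Basis. (w t \<bullet> b) *\<^sub>R dderiv (dderiv f b) y' (y t) + (w' \<bullet> b) *\<^sub>R dderiv f b (y t))
     = dderiv (dderiv f (w t)) y' (y t) + dderiv f w' (y t)"
    using dderiv_dderiv_linear[OF assms(1-3), of "w t" y']
      linear_Basis_sum[OF linear_dderiv[OF smooth_onD(1)[OF assms(2,3)]], of w']
    by (simp add: sum.distrib)
  moreover have "\<forall>\<^sub>F s in nhds t. (\<Sum>b\<in>Basis. (w s \<bullet> b) *\<^sub>R dderiv f b (y s)) = dderiv f (w s) (y s)"
  proof -
    have "isCont y t" using y has_vector_derivative_continuous by blast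
    then have "\<forall>\<^sub>F s in nhds t. y s \<in> S"
      using assms(1,3) by (simp add: continuous_at_eventually_in)
    then show ?thesis
    proof (rule eventually_mono)
      fix s assume "y s \<in> S"
      then show "(\<Sum>b\<in>Basis. (w s \<bullet> b) *\<^sub>R dderiv f b (y s)) = dderiv f (w s) (y s)"
        using linear_Basis_sum[OF linear_dderiv[OF smooth_onD(1)[OF assms(2)]], of "y s" "w s"] by simp
    qed
  qed
  ultimately show ?thesis
    using has_vector_derivative_eventually_eq by simp
qed

section \<open>Families of bilinear forms\<close>

definition quad_form :: "('e::euclidean_space \<Rightarrow> 'e \<Rightarrow> real) \<Rightarrow> 'e \<Rightarrow> 'e \<Rightarrow> real" where
  "quad_form k u w = (\<Sum>a\<in>Basis. \<Sum>b\<in>Basis. (u \<bullet> a) * (w \<bullet> b) * k a b)"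

text \<open>Writing a bilinear form through its matrix separates the dependence on a base point, which sits
  in the matrix entries, from the dependence on the two vectors.\<close>
lemma bilinear_eq_quad_form:
  assumes "bilinear B"
  shows "B u w = quad_form B u w"
proof -
  have "B u w = (\<Sum>a\<in>Basis. (u \<bullet> a) *\<^sub>R B a w)"
    using assms by (intro linear_Basis_sum) (auto simp: bilinear_def)
  also have "\<dots> = (\<Sum>a\<in>Basis. (u \<bullet> a) *\<^sub>R (\<Sum>b\<in>Basis. (w \<bullet> b) *\<^sub>R B a b))"
  proof (intro sum.cong refl)
    fix a
    have "linear (B a)" using assms by (auto simp: bilinear_def)
    then show "(u \<bullet> a) *\<^sub>R B a w = (u \<bullet> a) *\<^sub>R (\<Sum>b\<in>Basis. (w \<bullet> b) *\<^sub>R B a b)"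
      using linear_Basis_sum[of "B a" w] by metis
  qed
  finally show ?thesis by (simp add: quad_form_def sum_distrib_left mult.assoc)
qed

lemma abs_quad_form_le:
  "\<bar>quad_form k u w\<bar> \<le> (\<Sum>a\<in>Basis. \<Sum>b\<in>Basis. \<bar>k a b\<bar>) * norm u * norm w"
proof -
  have "\<bar>quad_form k u w\<bar> \<le> (\<Sum>a\<in>Basis. \<Sum>b\<in>Basis. \<bar>(u \<bullet> a) * (w \<bullet> b) * k a b\<bar>)"
    unfolding quad_form_def
    by (rule order_trans[OF sum_abs sum_mono]) (rule sum_abs)
  also have "\<dots> \<le> (\<Sum>a\<in>Basis. \<Sum>b\<in>Basis. \<bar>k a b\<bar> * (norm u * norm w))"
  proof (intro sum_mono)
    fix a b :: 'a assume "a \<in> Basis" "b \<in> Basis"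
    then have "\<bar>u \<bullet> a\<bar> * \<bar>w \<bullet> b\<bar> \<le> norm u * norm w"
      by (intro mult_mono) (auto simp: Basis_le_norm)
    then show "\<bar>(u \<bullet> a) * (w \<bullet> b) * k a b\<bar> \<le> \<bar>k a b\<bar> * (norm u * norm w)"
      by (simp add: abs_mult mult.commute mult_left_mono)
  qed
  finally show ?thesis by (simp add: sum_distrib_right mult.assoc)
qed

lemma quad_form_diff: "quad_form k u w - quad_form k' u w = quad_form (\<lambda>a b. k a b - k' a b) u w"
  by (simp add: quad_form_def sum_subtractf right_diff_distrib)

lemma quad_form_scale: "quad_form k (c *\<^sub>R u) (d *\<^sub>R w) = c * d * quad_form k u w"
  by (simp add: quad_form_def sum_distrib_left mult_ac)

lemma quad_form_diff_left: "quad_form k (u - v) w = quad_form k u w - quad_form k v w"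
  by (simp add: quad_form_def sum_subtractf left_diff_distrib inner_diff_left)

lemma linear_quad_form: "linear (\<lambda>u. quad_form k u w)" "linear (quad_form k u)"
  unfolding quad_form_def
  by (auto intro!: linearI simp: sum.distrib sum_distrib_left algebra_simps)

lemma continuous_on_quad_form: "continuous_on UNIV (\<lambda>s. quad_form k s s)"
  unfolding quad_form_def by (intro continuous_intros)

text \<open>Compactness of the unit sphere of \<open>S\<close> turns positivity at \<open>y0\<close> into a lower bound, and continuity
  of the finitely many matrix entries keeps half of it nearby. This serves twice: for the Hessian in the
  second derivative test, and for the metric in the Lipschitz estimate of the Christoffel form.\<close>
lemma locally_coercive:
  fixes k :: "'e::euclidean_space \<Rightarrow> 'e \<Rightarrow> 'y::t2_space \<Rightarrow> real"
  assumes cont: "\<And>a b. a \<in> Basis \<Longrightarrow> b \<in> Basis \<Longrightarrow> isCont (k a b) y0"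
    and S: "subspace S"
    and pos: "\<And>s. s \<in> S \<Longrightarrow> s \<noteq> 0 \<Longrightarrow> quad_form (\<lambda>a b. k a b y0) s s > 0"
  shows "\<exists>m>0. \<forall>\<^sub>F y in nhds y0. \<forall>s\<in>S. quad_form (\<lambda>a b. k a b y) s s \<ge> m * (norm s)\<^sup>2"
proof (cases "S \<inter> sphere 0 1 = {}")
  case True
  have "s = 0" if "s \<in> S" for s
  proof (rule ccontr)
    assume "s \<noteq> 0"
    then have "(1 / norm s) *\<^sub>R s \<in> S \<inter> sphere 0 1"
      using that S by (auto simp: subspace_scale)
    then show False using True by blast
  qed
  then have "\<forall>s\<in>S. quad_form (\<lambda>a b. k a b y) s s \<ge> 1 * (norm s)\<^sup>2" for y
    by (metis (no_types, lifting) mult_zero_right norm_zero order_refl quad_form_scale scale_zero_left mult_zero_left zero_power2)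
  then show ?thesis by (intro exI[of _ 1]) auto
next
  case False
  have "compact (S \<inter> sphere 0 1)"
    using closed_subspace[OF S] by (simp add: closed_Int_compact)
  then obtain s0 where s0: "s0 \<in> S \<inter> sphere 0 1"
    "\<And>s. s \<in> S \<inter> sphere 0 1 \<Longrightarrow> quad_form (\<lambda>a b. k a b y0) s0 s0 \<le> quad_form (\<lambda>a b. k a b y0) s s"
    using continuous_attains_inf[OF _ False continuous_on_subset[OF continuous_on_quad_form]] by (metis subset_UNIV)
  define m where "m = quad_form (\<lambda>a b. k a b y0) s0 s0 / 2"
  have m: "m > 0" using s0(1) pos[of s0] by (cases "s0 = 0") (auto simp: m_def)
  have "((\<lambda>y. \<Sum>a\<in>Basis. \<Sum>b\<in>Basis. \<bar>k a b y - k a b y0\<bar>) \<longlongrightarrow> 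
      (\<Sum>a\<in>(Basis::'e set). \<Sum>b\<in>(Basis::'e set). \<bar>k a b y0 - k a b y0\<bar>)) (nhds y0)"
    using cont by (intro tendsto_intros) (auto simp: isCont_def tendsto_at_iff_tendsto_nhds)
  then have "\<forall>\<^sub>F y in nhds y0. (\<Sum>a\<in>Basis. \<Sum>b\<in>Basis. \<bar>k a b y - k a b y0\<bar>) < m"
    using m by (intro order_tendstoD(2)) auto
  then have "\<forall>\<^sub>F y in nhds y0. \<forall>s\<in>S. quad_form (\<lambda>a b. k a b y) s s \<ge> m * (norm s)\<^sup>2"
  proof (rule eventually_mono, intro ballI)
    fix y s assume y: "(\<Sum>a\<in>Basis. \<Sum>b\<in>Basis. \<bar>k a b y - k a b y0\<bar>) < m" and s: "s \<in> S"
    show "quad_form (\<lambda>a b. k a b y) s s \<ge> m * (norm s)\<^sup>2"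
    proof (cases "s = 0")
      case True then show ?thesis by (simp add: quad_form_def)
    next
      case nz: False
      define e where "e = (1 / norm s) *\<^sub>R s"
      have e: "e \<in> S \<inter> sphere 0 1" "s = norm s *\<^sub>R e" "norm e = 1"
        using s S nz by (auto simp: e_def subspace_scale)
      have "\<bar>quad_form (\<lambda>a b. k a b y) e e - quad_form (\<lambda>a b. k a b y0) e e\<bar> \<le> m"
        using abs_quad_form_le[of "\<lambda>a b. k a b y - k a b y0" e e] y e(3)
        by (simp add: quad_form_diff)
      then have "quad_form (\<lambda>a b. k a b y) e e \<ge> m"
        using s0(2)[OF e(1)] unfolding m_def abs_le_iff by linarith
      moreover have "quad_form (\<lambda>a b. k a b y) s s = (norm s)\<^sup>2 * quad_form (\<lambda>a b. k a b y) e e"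
        by (subst e(2), subst (2) e(2)) (simp only: quad_form_scale power2_eq_square)
      ultimately show ?thesis by (simp only: mult.commute[of m] mult_left_mono zero_le_power2)
    qed
  qed
  then show ?thesis using m by blast
qed

text \<open>The map \<open>A\<close> that represents \<open>B\<close> through the Euclidean inner product is injective by
  definiteness, hence bijective in finite dimension.\<close>
lemma posdef_bilinear_representation:
  fixes B :: "'e::euclidean_space \<Rightarrow> 'e \<Rightarrow> real"
  assumes B: "bilinear B" and pos: "\<And>u. u \<noteq> 0 \<Longrightarrow> B u u > 0" and l: "linear l"
  shows "\<exists>!z. \<forall>w. B z w = l w"
proof -
  define A where "A z = (\<Sum>b\<in>Basis. B z b *\<^sub>R b)" for z
  have lin1: "linear (\<lambda>z. B z w)" and lin2: "linear (B w)" for w using B by (auto simp: bilinear_def)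
  have A: "A z \<bullet> w = B z w" for z w
    using linear_Basis_sum[OF lin2, of z w]
    by (simp add: A_def inner_sum_left inner_commute[of w] mult.commute)
  have linA: "linear A"
    unfolding A_def
    by (intro linear_compose_sum ballI linearI)
      (auto simp: linear_add[OF lin1] linear_cmul[OF lin1] algebra_simps)
  have "inj A"
  proof (subst linear_injective_0[OF linA], intro allI impI)
    fix u assume "A u = 0"
    then have "B u u = 0" using A[of u u] by simp
    then show "u = 0" using pos[of u] by fastforce
  qed
  then have "surj A" using linear_injective_imp_surjective[OF linA] by blast
  then obtain z where z: "A z = (\<Sum>b\<in>Basis. l b *\<^sub>R b)" by (metis surjD)
  have "B z w = l w" for w
  proof -
    have "B z w = (\<Sum>b\<in>Basis. l b *\<^sub>R b) \<bullet> w" using A[of z w] z by simp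
    then show ?thesis using linear_Basis_sum[OF l, of w]
      by (simp add: inner_sum_left inner_commute[of w] mult.commute)
  qed
  moreover have "y = z" if "\<forall>w. B y w = l w" for y
  proof -
    have "A y = A z" using that calculation A by (metis vector_eq_rdot)
    then show ?thesis using \<open>inj A\<close> by (simp add: inj_def)
  qed
  ultimately show ?thesis by blast
qed

text \<open>Existence comes from the representation lemma for an auxiliary form on the whole space: if \<open>P\<close> is
  any linear projection onto \<open>T\<close>, then \<open>C(u,w) = B(Pu,Pw) + B(u-Pu,w-Pw)\<close> is definite, and the vector
  \<open>t\<close> that represents \<open>w \<mapsto> B(z,Pw)\<close> yields the component \<open>Pt\<close> of \<open>z\<close> in \<open>T\<close>.\<close>
lemma posdef_bilinear_orthogonal_projection:
  fixes B :: "'e::euclidean_space \<Rightarrow> 'e \<Rightarrow> real"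
  assumes B: "bilinear B" and pos: "\<And>u. u \<noteq> 0 \<Longrightarrow> B u u > 0" and T: "subspace T"
  shows "\<exists>!w. (\<forall>X\<in>T. B w X = 0) \<and> z - w \<in> T"
proof -
  have lin1: "linear (\<lambda>z. B z w)" and lin2: "linear (B w)" for w using B by (auto simp: bilinear_def)
  obtain P where P: "range P \<subseteq> T" "linear P" "\<And>v. v \<in> T \<Longrightarrow> P v = v"
    using linear_exists_left_inverse_on[OF linear_id T] by auto
  define C where "C u w = B (P u) (P w) + B (u - P u) (w - P w)" for u w
  note Pl = linear_add[OF P(2)] linear_cmul[OF P(2)]
  note Bl = linear_add[OF lin1] linear_add[OF lin2] linear_cmul[OF lin1] linear_cmul[OF lin2]
    linear_diff[OF lin1] linear_diff[OF lin2]
  have "bilinear C" unfolding bilinear_def C_def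
    by (intro conjI allI linearI) (simp_all add: Pl Bl algebra_simps)
  moreover have "C u u > 0" if "u \<noteq> 0" for u
  proof -
    have nn: "B v v \<ge> 0" for v using pos[of v] linear_0[OF lin2] by (cases "v = 0") (auto simp: less_imp_le)
    show ?thesis
    proof (cases "P u = 0")
      case True
      then show ?thesis using pos[OF that] by (simp add: C_def linear_0[OF lin2])
    next
      case False
      then show ?thesis using pos[OF False] nn[of "u - P u"] by (simp add: C_def)
    qed
  qed
  moreover have "linear (\<lambda>w. B z (P w))"
    using linear_compose[OF P(2) lin2] by (simp add: o_def)
  ultimately obtain t where t: "\<And>w. C t w = B z (P w)"
    using posdef_bilinear_representation[of C "\<lambda>w. B z (P w)"] by blast
  have Pt: "P t \<in> T" using P(1) by blast
  have ex: "(\<forall>X\<in>T. B (z - P t) X = 0) \<and> z - (z - P t) \<in> T"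
  proof (intro conjI ballI)
    fix X assume X: "X \<in> T"
    have "B (P t) X = B z X" using t[of X] P(3)[OF X] by (simp add: C_def linear_0[OF lin2])
    then show "B (z - P t) X = 0" by (simp add: linear_diff[OF lin1])
  qed (use Pt in simp)
  moreover have "w = z - P t" if "(\<forall>X\<in>T. B w X = 0) \<and> z - w \<in> T" for w
  proof -
    have "w - (z - P t) = P t - (z - w)" by simp
    then have d: "w - (z - P t) \<in> T" using that Pt T by (metis subspace_diff)
    then have "B (w - (z - P t)) (w - (z - P t)) = B w (w - (z - P t)) - B (z - P t) (w - (z - P t))"
      by (simp only: linear_diff[OF lin1])
    then have "B (w - (z - P t)) (w - (z - P t)) = 0" using d that ex by simp
    then show ?thesis using pos[of "w - (z - P t)"] by fastforce
  qed
  ultimately show ?thesis by blast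
qed

section \<open>Local uniqueness for ordinary differential equations\<close>

text \<open>To the right of \<open>t0\<close> the function \<open>e(t) exp(-Ct)\<close> does not increase, to the left of \<open>t0\<close> the function
  \<open>e(t) exp(Ct)\<close> does not decrease as \<open>t\<close> grows.\<close>
lemma gronwall_zero:
  fixes e e' :: "real \<Rightarrow> real"
  assumes d: "\<And>t. t \<in> {a<..<b} \<Longrightarrow> (e has_real_derivative e' t) (at t)"
    and le: "\<And>t. t \<in> {a<..<b} \<Longrightarrow> \<bar>e' t\<bar> \<le> C * e t"
    and t0: "t0 \<in> {a<..<b}" "e t0 = 0" and t: "t \<in> {a<..<b}"
  shows "e t \<le> 0"
proof (cases "t0 \<le> t")
  case True
  have "e t * exp (- C * t) \<le> e t0 * exp (- C * t0)"
  proof (rule DERIV_nonpos_imp_nonincreasing[OF True])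
    fix s assume "t0 \<le> s" "s \<le> t"
    then have s: "s \<in> {a<..<b}" using t0 t by auto
    have "((\<lambda>t. e t * exp (- C * t)) has_real_derivative (e' s - C * e s) * exp (- C * s)) (at s)"
      by (auto intro!: derivative_eq_intros d[OF s] simp: algebra_simps)
    moreover have "(e' s - C * e s) * exp (- C * s) \<le> 0"
      using le[OF s] by (simp add: mult_le_0_iff)
    ultimately show "\<exists>y. ((\<lambda>t. e t * exp (- C * t)) has_real_derivative y) (at s) \<and> y \<le> 0" by blast
  qed
  then show ?thesis using t0 by (simp add: mult_le_0_iff)
next
  case False
  have "e t * exp (C * t) \<le> e t0 * exp (C * t0)"
  proof (rule DERIV_nonneg_imp_nondecreasing[where f = "\<lambda>t. e t * exp (C * t)"])
    show "t \<le> t0" using False by simp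
    fix s assume "t \<le> s" "s \<le> t0"
    then have s: "s \<in> {a<..<b}" using t0 t by auto
    have "((\<lambda>t. e t * exp (C * t)) has_real_derivative (e' s + C * e s) * exp (C * s)) (at s)"
      by (auto intro!: derivative_eq_intros d[OF s] simp: algebra_simps)
    moreover have "(e' s + C * e s) * exp (C * s) \<ge> 0"
      using le[OF s] by (simp add: zero_le_mult_iff)
    ultimately show "\<exists>y. ((\<lambda>t. e t * exp (C * t)) has_real_derivative y) (at s) \<and> y \<ge> 0" by blast
  qed
  then show ?thesis using t0 by (simp add: mult_le_0_iff)
qed

text \<open>Lipschitz continuity on some neighbourhood of \<open>x\<close>, phrased as an eventual inequality for pairs
  close to the diagonal point \<open>(x, x)\<close>, so that neighbourhoods never have to be intersected or shrunk
  by hand.\<close>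
definition lipschitz_at :: "('a::real_normed_vector \<Rightarrow> 'b::real_normed_vector) \<Rightarrow> 'a \<Rightarrow> bool" where
  "lipschitz_at f x \<longleftrightarrow> (\<exists>L\<ge>0. \<forall>\<^sub>F p in nhds (x, x). norm (f (fst p) - f (snd p)) \<le> L * norm (fst p - snd p))"

lemma tendsto_nhds_fst_snd:
  "((\<lambda>p. fst p) \<longlongrightarrow> x) (nhds (x, y))" "((\<lambda>p. snd p) \<longlongrightarrow> y) (nhds (x, y))"
  using tendsto_fst[OF filterlim_ident[of "nhds (x,y)"]] tendsto_snd[OF filterlim_ident[of "nhds (x,y)"]] by auto

lemma lipschitz_at_isCont:
  assumes "lipschitz_at f x" shows "isCont f x"
proof -
  obtain L where L: "\<forall>\<^sub>F p in nhds (x, x). norm (f (fst p) - f (snd p)) \<le> L * norm (fst p - snd p)"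
    using assms by (auto simp: lipschitz_at_def)
  have "((\<lambda>y. (y, x)) \<longlongrightarrow> (x, x)) (nhds x)" by (intro tendsto_intros filterlim_ident)
  from eventually_compose_filterlim[OF L this]
  have "\<forall>\<^sub>F y in nhds x. norm (f y - f x) \<le> L * norm (y - x)" by simp
  moreover have "((\<lambda>y. L * norm (y - x)) \<longlongrightarrow> 0) (nhds x)"
    using tendsto_mult_left[OF tendsto_norm[OF tendsto_diff[OF filterlim_ident[of "nhds x"] tendsto_const[of x]]], of L]
    by simp
  ultimately have "((\<lambda>y. f y - f x) \<longlongrightarrow> 0) (nhds x)"
    by (rule Lim_null_comparison)
  then have "(f \<longlongrightarrow> f x) (nhds x)" by (rule LIM_zero_cancel)
  then show ?thesis by (simp add: isCont_def tendsto_at_iff_tendsto_nhds)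
qed

lemma isCont_bounded_near_diagonal:
  assumes "isCont f x"
  shows "\<forall>\<^sub>F p in nhds (x, x). norm (f (fst p)) \<le> norm (f x) + 1 \<and> norm (f (snd p)) \<le> norm (f x) + 1"
proof -
  have "((\<lambda>y. norm (f y)) \<longlongrightarrow> norm (f x)) (nhds x)"
    using assms by (intro tendsto_norm) (simp add: isCont_def tendsto_at_iff_tendsto_nhds)
  then have e: "\<forall>\<^sub>F y in nhds x. norm (f y) < norm (f x) + 1" by (intro order_tendstoD(2)) auto
  show ?thesis
    using eventually_compose_filterlim[OF e tendsto_nhds_fst_snd(1)[of x x]]
      eventually_compose_filterlim[OF e tendsto_nhds_fst_snd(2)[of x x]]
    by eventually_elim auto
qed

lemma lipschitz_at_const: "lipschitz_at (\<lambda>x. c) x"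
  unfolding lipschitz_at_def by (intro exI[of _ 0]) simp

lemma lipschitz_at_bounded_linear:
  assumes "bounded_linear f" shows "lipschitz_at f x"
proof -
  have "norm (f (fst p) - f (snd p)) \<le> onorm f * norm (fst p - snd p)" for p
    using onorm[OF assms, of "fst p - snd p"] by (simp add: bounded_linear.linear[OF assms] linear_diff)
  then show ?thesis unfolding lipschitz_at_def using onorm_pos_le[OF assms] by (intro exI[of _ "onorm f"]) auto
qed

lemma lipschitz_at_compose:
  assumes "lipschitz_at f (g x)" "lipschitz_at g x"
  shows "lipschitz_at (\<lambda>y. f (g y)) x"
proof -
  obtain L where L: "L \<ge> 0" "\<forall>\<^sub>F p in nhds (g x, g x). norm (f (fst p) - f (snd p)) \<le> L * norm (fst p - snd p)"
    using assms by (auto simp: lipschitz_at_def)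
  obtain K where K: "K \<ge> 0" "\<forall>\<^sub>F p in nhds (x, x). norm (g (fst p) - g (snd p)) \<le> K * norm (fst p - snd p)"
    using assms by (auto simp: lipschitz_at_def)
  have g: "(g \<longlongrightarrow> g x) (nhds x)" using lipschitz_at_isCont[OF assms(2)]
    by (simp add: isCont_def tendsto_at_iff_tendsto_nhds)
  have "((\<lambda>p. (g (fst p), g (snd p))) \<longlongrightarrow> (g x, g x)) (nhds (x, x))"
    by (intro tendsto_Pair filterlim_compose[OF g] tendsto_nhds_fst_snd)
  from eventually_compose_filterlim[OF L(2) this] K(2)
  have "\<forall>\<^sub>F p in nhds (x, x). norm (f (g (fst p)) - f (g (snd p))) \<le> (L * K) * norm (fst p - snd p)"
  proof eventually_elim
    case (elim p)
    then show ?case using mult_left_mono[OF elim(2) L(1)] by (simp add: mult.assoc)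
  qed
  then show ?thesis unfolding lipschitz_at_def using L K by (intro exI[of _ "L * K"]) auto
qed

lemma lipschitz_at_add:
  assumes "lipschitz_at f x" "lipschitz_at g x"
  shows "lipschitz_at (\<lambda>y. f y + g y) x"
proof -
  obtain L where L: "L \<ge> 0" "\<forall>\<^sub>F p in nhds (x, x). norm (f (fst p) - f (snd p)) \<le> L * norm (fst p - snd p)"
    using assms by (auto simp: lipschitz_at_def)
  obtain K where K: "K \<ge> 0" "\<forall>\<^sub>F p in nhds (x, x). norm (g (fst p) - g (snd p)) \<le> K * norm (fst p - snd p)"
    using assms by (auto simp: lipschitz_at_def)
  have "\<forall>\<^sub>F p in nhds (x, x). norm ((f (fst p) + g (fst p)) - (f (snd p) + g (snd p))) \<le> (L + K) * norm (fst p - snd p)"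
    using L(2) K(2)
  proof eventually_elim
    case (elim p)
    then show ?case using norm_triangle_ineq[of "f (fst p) - f (snd p)" "g (fst p) - g (snd p)"]
      by (simp add: algebra_simps)
  qed
  then show ?thesis unfolding lipschitz_at_def using L K by (intro exI[of _ "L + K"]) auto
qed

lemma lipschitz_at_sum:
  "finite B \<Longrightarrow> (\<And>b. b \<in> B \<Longrightarrow> lipschitz_at (f b) x) \<Longrightarrow> lipschitz_at (\<lambda>y. \<Sum>b\<in>B. f b y) x"
  by (induction B rule: finite_induct) (auto intro: lipschitz_at_const lipschitz_at_add)

lemma lipschitz_at_scaleR:
  assumes "lipschitz_at f x" "lipschitz_at g x"
  shows "lipschitz_at (\<lambda>y. f y *\<^sub>R g y) x"
proof -
  obtain L where L: "L \<ge> 0" "\<forall>\<^sub>F p in nhds (x, x). norm (f (fst p) - f (snd p)) \<le> L * norm (fst p - snd p)"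
    using assms by (auto simp: lipschitz_at_def)
  obtain K where K: "K \<ge> 0" "\<forall>\<^sub>F p in nhds (x, x). norm (g (fst p) - g (snd p)) \<le> K * norm (fst p - snd p)"
    using assms by (auto simp: lipschitz_at_def)
  define F G where "F = norm (f x) + 1" and "G = norm (g x) + 1"
  have FG: "F \<ge> 0" "G \<ge> 0" by (auto simp: F_def G_def)
  have "\<forall>\<^sub>F p in nhds (x, x). norm (f (fst p) *\<^sub>R g (fst p) - f (snd p) *\<^sub>R g (snd p)) \<le> (F * K + L * G) * norm (fst p - snd p)"
    using L(2) K(2) isCont_bounded_near_diagonal[OF lipschitz_at_isCont[OF assms(1)], folded F_def]
      isCont_bounded_near_diagonal[OF lipschitz_at_isCont[OF assms(2)], folded G_def]
  proof eventually_elim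
    case (elim p)
    have "f (fst p) *\<^sub>R g (fst p) - f (snd p) *\<^sub>R g (snd p)
       = f (fst p) *\<^sub>R (g (fst p) - g (snd p)) + (f (fst p) - f (snd p)) *\<^sub>R g (snd p)"
      by (simp add: algebra_simps)
    also have "norm \<dots> \<le> norm (f (fst p)) * norm (g (fst p) - g (snd p)) + norm (f (fst p) - f (snd p)) * norm (g (snd p))"
      by (metis norm_scaleR norm_triangle_ineq real_norm_def)
    also have "\<dots> \<le> F * (K * norm (fst p - snd p)) + (L * norm (fst p - snd p)) * G"
      using elim FG L K by (intro add_mono mult_mono) auto
    finally show ?case by (simp add: algebra_simps)
  qed
  then show ?thesis unfolding lipschitz_at_def using L K FG by (intro exI[of _ "F * K + L * G"]) auto
qed

lemma lipschitz_at_Pair: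
  assumes "lipschitz_at f x" "lipschitz_at g x"
  shows "lipschitz_at (\<lambda>y. (f y, g y)) x"
proof -
  have "lipschitz_at (\<lambda>y. (f y, 0) + (0, g y)) x"
    by (intro lipschitz_at_add assms
        lipschitz_at_compose[OF lipschitz_at_bounded_linear, of "\<lambda>a. (a, 0)"]
        lipschitz_at_compose[OF lipschitz_at_bounded_linear, of "\<lambda>b. (0, b)"]
        bounded_linear_Pair bounded_linear_ident bounded_linear_zero)
  then show ?thesis by simp
qed

text \<open>The sum \<open>q\<close> of the norms of the partial derivatives bounds the operator norm of the derivative and
  is continuous, hence bounded near \<open>x\<close>; the mean value inequality on a ball does the rest.\<close>
lemma smooth_on_lipschitz_at:
  fixes f :: "'a::euclidean_space \<Rightarrow> 'b::real_normed_vector"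
  assumes "open S" "smooth_on S f" "x \<in> S"
  shows "lipschitz_at f x"
proof -
  define q where "q y = (\<Sum>b\<in>Basis. norm (dderiv f b y))" for y
  have "continuous_on S q" unfolding q_def
    by (intro continuous_intros smooth_onD(3)[OF smooth_onD(2)[OF assms(2)]])
  then have "isCont q x" using assms continuous_on_eq_continuous_at by blast
  then have "(q \<longlongrightarrow> q x) (nhds x)" by (simp add: isCont_def tendsto_at_iff_tendsto_nhds)
  then have "\<forall>\<^sub>F y in nhds x. q y < q x + 1" by (intro order_tendstoD(2)) auto
  then have "\<forall>\<^sub>F y in nhds x. q y < q x + 1 \<and> y \<in> S"
    using eventually_nhds_in_open[OF assms(1,3)] by eventually_elim auto
  then obtain r where r: "r > 0" "\<And>y. dist y x < r \<Longrightarrow> q y < q x + 1 \<and> y \<in> S"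
    unfolding eventually_nhds_metric by blast
  have bd: "norm (f y - f z) \<le> (q x + 1) * norm (y - z)" if "y \<in> ball x r" "z \<in> ball x r" for y z
  proof (rule differentiable_bound[of "ball x r"])
    fix w assume w: "w \<in> ball x r"
    then have wS: "w \<in> S" "q w < q x + 1" using r by (auto simp: dist_commute)
    show "(f has_derivative (\<lambda>v. dderiv f v w)) (at w within ball x r)"
      using smooth_on_has_derivative[OF assms(2) wS(1)] has_derivative_at_withinI by blast
    show "onorm (\<lambda>v. dderiv f v w) \<le> q x + 1"
    proof (rule onorm_bound)
      show "0 \<le> q x + 1" by (auto simp: q_def intro!: add_nonneg_nonneg sum_nonneg)
      fix v
      have "dderiv f v w = (\<Sum>b\<in>Basis. (v \<bullet> b) *\<^sub>R dderiv f b w)"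
        by (rule linear_Basis_sum[OF linear_dderiv[OF smooth_onD(1)[OF assms(2) wS(1)]]])
      also have "norm \<dots> \<le> (\<Sum>b\<in>Basis. norm v * norm (dderiv f b w))"
        by (intro sum_norm_le) (auto intro!: mult_right_mono Basis_le_norm)
      also have "\<dots> = q w * norm v" by (simp add: q_def sum_distrib_left mult.commute)
      finally show "norm (dderiv f v w) \<le> (q x + 1) * norm v"
        using wS(2) by (meson less_imp_le mult_right_mono norm_ge_zero order_trans)
    qed
  qed (use that in auto)
  have "\<forall>\<^sub>F p in nhds (x, x). p \<in> ball x r \<times> ball x r"
    using r by (intro eventually_nhds_in_open) (auto intro: open_Times)
  then have "\<forall>\<^sub>F p in nhds (x, x). norm (f (fst p) - f (snd p)) \<le> (q x + 1) * norm (fst p - snd p)"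
    by eventually_elim (auto intro: bd)
  then show ?thesis unfolding lipschitz_at_def
    by (intro exI[of _ "q x + 1"]) (auto simp: q_def intro!: add_nonneg_nonneg sum_nonneg)
qed

text \<open>Gronwall's inequality for the squared distance of the two solutions.\<close>
lemma ode_unique_locally:
  fixes w1 w2 :: "real \<Rightarrow> 'a::real_inner"
  assumes "lipschitz_at X (w1 t0)" "w1 t0 = w2 t0"
    and d: "\<forall>\<^sub>F t in nhds t0. (w1 has_vector_derivative X (w1 t)) (at t) \<and> (w2 has_vector_derivative X (w2 t)) (at t)"
  shows "\<forall>\<^sub>F t in nhds t0. w1 t = w2 t"
proof -
  define x where "x = w1 t0"
  obtain L where L: "L \<ge> 0" "\<forall>\<^sub>F p in nhds (x, x). norm (X (fst p) - X (snd p)) \<le> L * norm (fst p - snd p)"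
    using assms by (auto simp: lipschitz_at_def x_def)
  have "isCont w1 t0" "isCont w2 t0"
    using eventually_nhds_x_imp_x[OF d] has_vector_derivative_continuous by blast+
  then have "(w1 \<longlongrightarrow> w1 t0) (nhds t0)" "(w2 \<longlongrightarrow> w2 t0) (nhds t0)"
    unfolding isCont_def tendsto_at_iff_tendsto_nhds by auto
  then have "(w1 \<longlongrightarrow> x) (nhds t0)" "(w2 \<longlongrightarrow> x) (nhds t0)"
    by (simp_all add: x_def assms(2))
  then have "((\<lambda>t. (w1 t, w2 t)) \<longlongrightarrow> (x, x)) (nhds t0)" by (intro tendsto_Pair)
  from eventually_compose_filterlim[OF L(2) this] d
  have "\<forall>\<^sub>F t in nhds t0. norm (X (w1 t) - X (w2 t)) \<le> L * norm (w1 t - w2 t) \<and>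
     (w1 has_vector_derivative X (w1 t)) (at t) \<and> (w2 has_vector_derivative X (w2 t)) (at t)"
    by eventually_elim auto
  then obtain r where r: "r > 0" "\<And>t. dist t t0 < r \<Longrightarrow> norm (X (w1 t) - X (w2 t)) \<le> L * norm (w1 t - w2 t) \<and>
     (w1 has_vector_derivative X (w1 t)) (at t) \<and> (w2 has_vector_derivative X (w2 t)) (at t)"
    unfolding eventually_nhds_metric by blast
  define e where "e t = (w1 t - w2 t) \<bullet> (w1 t - w2 t)" for t
  have "w1 t = w2 t" if t: "dist t t0 < r" for t
  proof -
    have "e t \<le> 0"
    proof (rule gronwall_zero[of "t0 - r" "t0 + r" e "\<lambda>t. 2 * ((w1 t - w2 t) \<bullet> (X (w1 t) - X (w2 t)))" "2 * L" t0])
      fix s assume s: "s \<in> {t0 - r<..<t0 + r}"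
      then have s: "dist s t0 < r" by (auto simp: dist_real_def)
      have "((\<lambda>s. w1 s - w2 s) has_vector_derivative X (w1 s) - X (w2 s)) (at s)"
        using r(2)[OF s] by (intro has_vector_derivative_diff) auto
      then have "((\<lambda>s. w1 s - w2 s) has_derivative (\<lambda>h. h *\<^sub>R (X (w1 s) - X (w2 s)))) (at s)"
        by (simp add: has_vector_derivative_def)
      from has_derivative_inner[OF this this]
      show "(e has_real_derivative 2 * ((w1 s - w2 s) \<bullet> (X (w1 s) - X (w2 s)))) (at s)"
        unfolding e_def has_field_derivative_def
        by (rule has_derivative_eq_rhs) (auto simp: fun_eq_iff inner_commute algebra_simps)
      have "\<bar>(w1 s - w2 s) \<bullet> (X (w1 s) - X (w2 s))\<bar> \<le> norm (w1 s - w2 s) * norm (X (w1 s) - X (w2 s))"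
        by (rule Cauchy_Schwarz_ineq2)
      also have "\<dots> \<le> norm (w1 s - w2 s) * (L * norm (w1 s - w2 s))"
        using r(2)[OF s] by (intro mult_left_mono) auto
      also have "\<dots> = L * e s" by (simp add: e_def dot_square_norm power2_eq_square)
      finally show "\<bar>2 * ((w1 s - w2 s) \<bullet> (X (w1 s) - X (w2 s)))\<bar> \<le> 2 * L * e s" by simp
    next
      show "e t0 = 0" using assms(2) by (simp add: e_def)
    qed (use r t in \<open>auto simp: dist_real_def\<close>)
    then show ?thesis unfolding e_def by (metis eq_iff_diff_eq_0 inner_eq_zero_iff inner_ge_zero order_antisym)
  qed
  then show ?thesis unfolding eventually_nhds_metric using r by blast
qed

text \<open>Let \<open>\<delta>\<close> be the difference of the solutions at \<open>y\<close> and \<open>y'\<close>. Testing the two systems with \<open>\<delta>\<close>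
  gives \<open>k\<^sub>y(\<delta>,\<delta>) = (r\<^sub>y - r\<^sub>y\<^sub>')(\<delta>) - (k\<^sub>y - k\<^sub>y\<^sub>')(z(y'),\<delta>)\<close>, whose left side is at least
  \<open>m |\<delta>|\<^sup>2\<close>. This avoids inverting the matrix.\<close>
lemma lipschitz_at_linear_system_solution:
  fixes k :: "'e::euclidean_space \<Rightarrow> 'e \<Rightarrow> 'y::real_normed_vector \<Rightarrow> real" and z :: "'y \<Rightarrow> 'e"
  assumes k: "\<And>a b. a \<in> Basis \<Longrightarrow> b \<in> Basis \<Longrightarrow> lipschitz_at (k a b) y0"
    and r: "\<And>b. b \<in> Basis \<Longrightarrow> lipschitz_at (r b) y0"
    and pos: "\<And>s. s \<noteq> 0 \<Longrightarrow> quad_form (\<lambda>a b. k a b y0) s s > 0"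
    and z: "\<forall>\<^sub>F y in nhds y0. \<forall>w. quad_form (\<lambda>a b. k a b y) (z y) w = (\<Sum>b\<in>Basis. (w \<bullet> b) * r b y)"
  shows "lipschitz_at z y0"
proof -
  obtain m where m: "m > 0" "\<forall>\<^sub>F y in nhds y0. \<forall>s\<in>UNIV. quad_form (\<lambda>a b. k a b y) s s \<ge> m * (norm s)\<^sup>2"
    using locally_coercive[where k=k and ?y0.0=y0 and S=UNIV] lipschitz_at_isCont[OF k] pos by (auto simp: subspace_UNIV)
  define R where "R y = (\<Sum>b\<in>Basis. r b y *\<^sub>R b)" for y
  have Rw: "(\<Sum>b\<in>Basis. (w \<bullet> b) * r b y) = R y \<bullet> w" for y w
    by (simp add: R_def inner_sum_left inner_commute[of w] mult.commute)
  have R: "lipschitz_at R y0" unfolding R_def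
    by (intro lipschitz_at_sum lipschitz_at_scaleR r lipschitz_at_const) auto
  then obtain LR where LR: "LR \<ge> 0" "\<forall>\<^sub>F p in nhds (y0, y0). norm (R (fst p) - R (snd p)) \<le> LR * norm (fst p - snd p)"
    by (auto simp: lipschitz_at_def)
  define RB where "RB = norm (R y0) + 1"
  define Lk where "Lk a b = (SOME L. L \<ge> 0 \<and>
    (\<forall>\<^sub>F p in nhds (y0, y0). norm (k a b (fst p) - k a b (snd p)) \<le> L * norm (fst p - snd p)))" for a b
  have "Lk a b \<ge> 0 \<and>
    (\<forall>\<^sub>F p in nhds (y0, y0). norm (k a b (fst p) - k a b (snd p)) \<le> Lk a b * norm (fst p - snd p))"
    if "a \<in> Basis" "b \<in> Basis" for a b
    unfolding Lk_def by (rule someI_ex) (rule k[OF that, unfolded lipschitz_at_def])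
  then have Lk: "\<And>a b. a \<in> Basis \<Longrightarrow> b \<in> Basis \<Longrightarrow> Lk a b \<ge> 0"
    "\<And>a b. a \<in> Basis \<Longrightarrow> b \<in> Basis \<Longrightarrow> \<forall>\<^sub>F p in nhds (y0, y0). norm (k a b (fst p) - k a b (snd p)) \<le> Lk a b * norm (fst p - snd p)"
    by auto
  define K where "K = (\<Sum>a\<in>Basis. \<Sum>b\<in>Basis. Lk a b)"
  have K0: "K \<ge> 0" unfolding K_def by (intro sum_nonneg Lk)
  have "\<forall>\<^sub>F p in nhds (y0, y0). \<forall>a\<in>Basis. \<forall>b\<in>Basis. norm (k a b (fst p) - k a b (snd p)) \<le> Lk a b * norm (fst p - snd p)"
    by (intro eventually_ball_finite ballI Lk finite_Basis)
  then have KK: "\<forall>\<^sub>F p in nhds (y0, y0). (\<Sum>a\<in>Basis. \<Sum>b\<in>Basis. \<bar>k a b (fst p) - k a b (snd p)\<bar>) \<le> K * norm (fst p - snd p)"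
  proof eventually_elim
    case (elim p)
    then have "(\<Sum>a\<in>Basis. \<Sum>b\<in>Basis. \<bar>k a b (fst p) - k a b (snd p)\<bar>) \<le> (\<Sum>a\<in>Basis. \<Sum>b\<in>Basis. Lk a b * norm (fst p - snd p))"
      by (intro sum_mono) auto
    then show ?case by (simp add: K_def sum_distrib_right)
  qed
  note e1 = eventually_compose_filterlim[OF m(2) tendsto_nhds_fst_snd(1)[of y0 y0]]
    and e2 = eventually_compose_filterlim[OF m(2) tendsto_nhds_fst_snd(2)[of y0 y0]]
    and e3 = eventually_compose_filterlim[OF z tendsto_nhds_fst_snd(1)[of y0 y0]]
    and e4 = eventually_compose_filterlim[OF z tendsto_nhds_fst_snd(2)[of y0 y0]]
  have "\<forall>\<^sub>F p in nhds (y0, y0). norm (z (fst p) - z (snd p)) \<le> ((LR + K * (RB / m)) / m) * norm (fst p - snd p)"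
    using e1 e2 e3 e4 KK LR(2) isCont_bounded_near_diagonal[OF lipschitz_at_isCont[OF R], folded RB_def]
  proof eventually_elim
    case (elim p)
    obtain y y' where p: "p = (y, y')" by fastforce
    define d where "d = z y - z y'"
    define n where "n = norm (y - y')"
    \<comment> \<open>an a priori bound for the solution, from testing its own system with itself\<close>
    have zb: "norm (z y') \<le> RB / m"
    proof (cases "z y' = 0")
      case True then show ?thesis using m by (simp add: RB_def)
    next
      case False
      have "m * (norm (z y'))\<^sup>2 \<le> R y' \<bullet> z y'" using elim(2,4) by (metis UNIV_I p snd_conv Rw)
      also have "\<dots> \<le> norm (R y') * norm (z y')" by (rule norm_cauchy_schwarz)
      also have "\<dots> \<le> RB * norm (z y')" using elim(7) p by (intro mult_right_mono) auto
      finally have "m * norm (z y') \<le> RB" using False by (simp add: power2_eq_square)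
      then show ?thesis using m by (simp add: field_simps)
    qed
    have "m * (norm d)\<^sup>2 \<le> quad_form (\<lambda>a b. k a b y) d d" using elim(1) p by simp
    also have "\<dots> = R y \<bullet> d - quad_form (\<lambda>a b. k a b y) (z y') d"
      using elim(3) p unfolding d_def quad_form_diff_left by (simp add: Rw)
    also have "\<dots> = (R y - R y') \<bullet> d - quad_form (\<lambda>a b. k a b y - k a b y') (z y') d"
      using elim(4) p by (simp add: Rw inner_diff_left quad_form_diff[symmetric])
    also have "\<dots> \<le> norm (R y - R y') * norm d + (K * n) * norm (z y') * norm d"
    proof -
      have "\<bar>quad_form (\<lambda>a b. k a b y - k a b y') (z y') d\<bar> \<le> (K * n) * norm (z y') * norm d"
        using elim(5) p by (intro order_trans[OF abs_quad_form_le] mult_right_mono) (auto simp: n_def)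
      then show ?thesis using norm_cauchy_schwarz[of "R y - R y'" d] by linarith
    qed
    also have "\<dots> \<le> (LR * n) * norm d + (K * n) * (RB / m) * norm d"
      using elim(6) p zb K0 by (intro add_mono mult_right_mono mult_left_mono) (auto simp: n_def)
    also have "\<dots> = ((LR + K * (RB / m)) * n) * norm d" by (simp add: algebra_simps)
    finally have "m * norm d \<le> (LR + K * (RB / m)) * n \<or> d = 0" by (cases "d = 0") (auto simp: power2_eq_square)
    then have "m * norm d \<le> (LR + K * (RB / m)) * n"
      using LR K0 m by (auto simp: n_def RB_def)
    then have "norm d \<le> ((LR + K * (RB / m)) * n) / m" using m by (simp add: field_simps)
    then show ?case by (simp add: d_def p n_def)
  qed
  then show ?thesis unfolding lipschitz_at_def using LR K0 m 
    by (intro exI[of _ "(LR + K * (RB / m)) / m"]) (auto simp: RB_def)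
qed

section \<open>Charts and coordinate changes\<close>

lemma isCont_eq_at_limit:
  fixes F G :: "'a::t2_space \<Rightarrow> 'b::t2_space"
  assumes "isCont F t" "isCont G t" "t islimpt A" "\<And>s. s \<in> A \<Longrightarrow> F s = G s"
  shows "F t = G t"
proof (rule tendsto_unique)
  show "at t within A \<noteq> bot" using assms(3) by (simp add: trivial_limit_within)
  show "(F \<longlongrightarrow> F t) (at t within A)"
    using assms(1) unfolding isCont_def by (rule tendsto_within_subset) simp
  have "(G \<longlongrightarrow> G t) (at t within A)"
    using assms(2) unfolding isCont_def by (rule tendsto_within_subset) simp
  moreover have "\<forall>\<^sub>F s in at t within A. G s = F s"
    using assms(4) by (simp add: eventually_at_filter)
  ultimately show "(F \<longlongrightarrow> G t) (at t within A)" by (rule Lim_transform_eventually)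
qed

locale smooth_atlas =
  fixes N :: "('p::{t2_space, second_countable_topology}, 'e::euclidean_space) chart set"
  assumes smooth_manifold: "smooth_manifold N"
begin

lemma open_dom: "c \<in> N \<Longrightarrow> open (dom_chart c)"
  and open_range: "c \<in> N \<Longrightarrow> open (coords c ` dom_chart c)"
  and chart_homeomorphism: "c \<in> N \<Longrightarrow> homeomorphism (dom_chart c) (coords c ` dom_chart c) (coords c) (point c)"
proof -
  have "\<forall>c\<in>N. is_chart c" using smooth_manifold unfolding smooth_manifold_def by (elim conjE)
  then show "c \<in> N \<Longrightarrow> open (dom_chart c)" "c \<in> N \<Longrightarrow> open (coords c ` dom_chart c)"
    "c \<in> N \<Longrightarrow> homeomorphism (dom_chart c) (coords c ` dom_chart c) (coords c) (point c)"
    by (simp_all add: is_chart_def)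
qed

lemma point_coords [simp]: "c \<in> N \<Longrightarrow> p \<in> dom_chart c \<Longrightarrow> point c (coords c p) = p"
  using chart_homeomorphism by (metis homeomorphism_apply1)

lemma open_coords_image:
  assumes "c \<in> N" "open W" shows "open (coords c ` (W \<inter> dom_chart c))"
proof -
  have "openin (top_of_set (coords c ` dom_chart c)) (coords c ` (W \<inter> dom_chart c))"
    using homeomorphism_imp_open_map[OF chart_homeomorphism[OF assms(1)]] assms(2)
    by (metis inf_commute openin_open_Int)
  then show ?thesis using open_range[OF assms(1)] openin_open_trans by blast
qed

lemma continuous_on_point:
  assumes "c \<in> N" shows "continuous_on (coords c ` dom_chart c) (point c)"
  by (rule homeomorphism_cont2[OF chart_homeomorphism[OF assms]])

lemma chart_at: "chart_at N p \<in> N" "p \<in> dom_chart (chart_at N p)"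
proof -
  have "(\<Union>c\<in>N. dom_chart c) = UNIV" using smooth_manifold unfolding smooth_manifold_def by (elim conjE)
  then have "\<exists>c. c \<in> N \<and> p \<in> dom_chart c" by blast
  from someI_ex[OF this] show "chart_at N p \<in> N" "p \<in> dom_chart (chart_at N p)"
    by (auto simp: chart_at_def)
qed

lemma smooth_transition:
  "c \<in> N \<Longrightarrow> d \<in> N \<Longrightarrow> smooth_on (coords c ` (dom_chart c \<inter> dom_chart d)) (\<lambda>y. coords d (point c y))"
proof -
  assume "c \<in> N" "d \<in> N"
  moreover have "\<forall>c\<in>N. \<forall>d\<in>N. smoothly_compatible c d"
    using smooth_manifold unfolding smooth_manifold_def by (elim conjE)
  ultimately have "smoothly_compatible c d" by blast
  then show ?thesis by (simp add: smoothly_compatible_def o_def)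
qed

lemma open_overlap: "c \<in> N \<Longrightarrow> d \<in> N \<Longrightarrow> open (coords c ` (dom_chart c \<inter> dom_chart d))"
  using open_coords_image[of c "dom_chart d"] open_dom by (simp add: inf_commute)

lemma coord_change_eq_dderiv:
  "coord_change c d p v = dderiv (\<lambda>y. coords d (point c y)) v (coords c p)"
  by (simp add: coord_change_def o_def)

lemma coord_change_has_derivative:
  assumes "c \<in> N" "d \<in> N" "p \<in> dom_chart c" "p \<in> dom_chart d"
  shows "((\<lambda>y. coords d (point c y)) has_derivative coord_change c d p) (at (coords c p))"
  using smooth_on_has_derivative[OF smooth_transition[OF assms(1,2)], of "coords c p"] assms
  by (simp add: coord_change_eq_dderiv[symmetric])

lemma linear_coord_change:
  assumes "c \<in> N" "d \<in> N" "p \<in> dom_chart c" "p \<in> dom_chart d"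
  shows "linear (coord_change c d p)"
  using has_derivative_linear[OF coord_change_has_derivative[OF assms]] .

text \<open>The cocycle rule for tangent vectors, from the chain rule for the transition maps. It
  relates vectors given in the chosen charts \<open>chart_at N p\<close> to their components in other charts.\<close>
lemma coord_change_compose:
  assumes "c \<in> N" "d \<in> N" "e \<in> N" "p \<in> dom_chart c" "p \<in> dom_chart d" "p \<in> dom_chart e"
  shows "coord_change d e p (coord_change c d p v) = coord_change c e p v"
proof -
  have "((\<lambda>y. coords e (point d (coords d (point c y)))) has_derivative
      (\<lambda>v. coord_change d e p (coord_change c d p v))) (at (coords c p))"
    using has_derivative_compose[OF coord_change_has_derivative[OF assms(1,2,4,5)],
      of "\<lambda>y. coords e (point d y)" "coord_change d e p"]
      coord_change_has_derivative[OF assms(2,3,5,6)] assms by simp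
  then have "((\<lambda>y. coords e (point c y)) has_derivative
      (\<lambda>v. coord_change d e p (coord_change c d p v))) (at (coords c p))"
    by (rule has_derivative_cong_open[OF _ open_overlap[OF assms(1,2)]]) (use assms in auto)
  then show ?thesis
    using has_derivative_unique[OF _ coord_change_has_derivative[OF assms(1,3,4,6)]] by (metis)
qed

lemma coord_change_self:
  assumes "c \<in> N" "p \<in> dom_chart c" shows "coord_change c c p v = v"
proof -
  have "((\<lambda>y. coords c (point c y)) has_derivative (\<lambda>v. v)) (at (coords c p))"
    by (rule has_derivative_cong_open[OF has_derivative_ident open_range[OF assms(1)]]) (use assms in auto)
  then show ?thesis
    using has_derivative_unique[OF _ coord_change_has_derivative[OF assms(1,1,2,2)]] by metis
qed

lemma coord_change_inverse:
  assumes "c \<in> N" "d \<in> N" "p \<in> dom_chart c" "p \<in> dom_chart d"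
  shows "coord_change d c p (coord_change c d p v) = v"
  using coord_change_compose[OF assms(1,2,1,3,4,3)] coord_change_self[OF assms(1,3)] by simp

lemma inj_coord_change:
  assumes "c \<in> N" "d \<in> N" "p \<in> dom_chart c" "p \<in> dom_chart d"
  shows "inj (coord_change c d p)"
  using coord_change_inverse[OF assms] by (metis injI)

lemma has_vector_derivative_change_chart:
  assumes "c \<in> N" "d \<in> N" "\<gamma> t \<in> dom_chart c" "\<gamma> t \<in> dom_chart d" "isCont \<gamma> t"
    and "((\<lambda>s. coords c (\<gamma> s)) has_vector_derivative v) (at t)"
  shows "((\<lambda>s. coords d (\<gamma> s)) has_vector_derivative coord_change c d (\<gamma> t) v) (at t)"
proof -
  have "((\<lambda>s. coords d (point c (coords c (\<gamma> s)))) has_vector_derivative coord_change c d (\<gamma> t) v) (at t)"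
    by (rule has_vector_derivative_along_curve[OF coord_change_has_derivative[OF assms(1-4)] assms(6)])
  moreover have "\<forall>\<^sub>F s in nhds t. coords d (point c (coords c (\<gamma> s))) = coords d (\<gamma> s)"
    using continuous_at_eventually_in[OF assms(5) open_dom[OF assms(1)] assms(3)]
    by eventually_elim (use assms in simp)
  ultimately show ?thesis by (rule has_vector_derivative_eventually_eq)
qed

lemma smooth_into_chart:
  assumes "smooth_into N I \<gamma>" "open I" "c \<in> N"
  shows "open (I \<inter> \<gamma> -` dom_chart c)" "smooth_on (I \<inter> \<gamma> -` dom_chart c) (\<lambda>t. coords c (\<gamma> t))"
    and "t \<in> I \<Longrightarrow> isCont \<gamma> t"
proof -
  have cont: "continuous_on I \<gamma>" using assms by (simp add: smooth_into_def)
  then have "\<forall>B. open B \<longrightarrow> open (\<gamma> -` B \<inter> I)" by (simp only: continuous_on_open_vimage[OF assms(2)])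
  then show "open (I \<inter> \<gamma> -` dom_chart c)" using open_dom[OF assms(3)] by (metis inf_commute)
  show "smooth_on (I \<inter> \<gamma> -` dom_chart c) (\<lambda>t. coords c (\<gamma> t))"
    using assms by (simp add: smooth_into_def o_def)
  show "isCont \<gamma> t" if "t \<in> I"
    using cont that by (simp only: continuous_on_eq_continuous_at[OF assms(2)])
qed

text \<open>The velocity, defined in a chart that varies with the point, can be computed in any fixed chart.\<close>
lemma velocity_in_chart:
  assumes "smooth_into N I \<gamma>" "open I" "t \<in> I" "c \<in> N" "\<gamma> t \<in> dom_chart c"
  shows "velocity N \<gamma> t = coord_change c (chart_at N (\<gamma> t)) (\<gamma> t) (dderiv (\<lambda>s. coords c (\<gamma> s)) 1 t)"
  unfolding velocity_def o_def
  by (intro vector_derivative_at has_vector_derivative_change_chart assms chart_at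
      smooth_into_chart(3)[OF assms(1,2,4,3)] smooth_curve_vector_derivative(1)[OF smooth_into_chart(2)[OF assms(1,2,4)]])
    (use assms in auto)

end

section \<open>The Christoffel form\<close>

locale riemannian = smooth_atlas +
  fixes g
  assumes riemannian_manifold: "riemannian_manifold N g"
begin

lemma metric: "bilinear (g p)" "g p u v = g p v u" "u \<noteq> 0 \<Longrightarrow> g p u u > 0"
  using riemannian_manifold by (auto simp: riemannian_manifold_def)

abbreviation "G c y \<equiv> metric_in_chart N g c y"

lemma smooth_metric: "c \<in> N \<Longrightarrow> smooth_on (coords c ` dom_chart c) (\<lambda>y. G c y u v)"
  using riemannian_manifold by (auto simp: riemannian_manifold_def)

lemma metric_in_chart:
  assumes "c \<in> N" "y \<in> coords c ` dom_chart c"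
  shows "bilinear (G c y)" "u \<noteq> 0 \<Longrightarrow> G c y u u > 0"
proof -
  define p where "p = point c y"
  define T where "T = coord_change c (chart_at N p) p"
  have p: "p \<in> dom_chart c" using assms by (auto simp: p_def)
  have G: "G c y u v = g p (T u) (T v)" for u v by (simp add: metric_in_chart_def p_def T_def Let_def)
  have T: "linear T" "inj T" unfolding T_def
    using linear_coord_change[OF assms(1) chart_at(1) p chart_at(2)]
      inj_coord_change[OF assms(1) chart_at(1) p chart_at(2)] by auto
  have lin1: "linear (\<lambda>z. g p z w)" and lin2: "linear (g p w)" for w
    using metric(1) by (auto simp: bilinear_def)
  show "bilinear (G c y)" unfolding bilinear_def
    using linear_compose[OF T(1) lin1] linear_compose[OF T(1) lin2] by (simp add: o_def G[abs_def])
  show "G c y u u > 0" if "u \<noteq> 0"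
    using metric(3) T that linear_injective_0[OF T(1)] unfolding G by blast
qed

text \<open>The right-hand side of the Koszul formula for constant-component fields. The Christoffel form is
  the vector that represents half of it with respect to the metric.\<close>
definition koszul where
  "koszul c y u v w = dderiv (\<lambda>y'. G c y' v w) u y + dderiv (\<lambda>y'. G c y' u w) v y - dderiv (\<lambda>y'. G c y' u v) w y"

lemma dderiv_metric_quad_form:
  assumes "c \<in> N" "y \<in> coords c ` dom_chart c"
  shows "dderiv (\<lambda>y'. G c y' a b) w y = quad_form (\<lambda>i j. dderiv (\<lambda>y'. G c y' i j) w y) a b"
proof -
  have "((\<lambda>y'. quad_form (G c y') a b) has_derivative (\<lambda>w. quad_form (\<lambda>i j. dderiv (\<lambda>y'. G c y' i j) w y) a b)) (at y)"
    unfolding quad_form_def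
    by (intro has_derivative_sum has_derivative_mult_right smooth_on_has_derivative[OF smooth_metric[OF assms(1)] assms(2)])
  then have "((\<lambda>y'. G c y' a b) has_derivative (\<lambda>w. quad_form (\<lambda>i j. dderiv (\<lambda>y'. G c y' i j) w y) a b)) (at y)"
    by (rule has_derivative_cong_open[OF _ open_range[OF assms(1)] assms(2)])
      (metis bilinear_eq_quad_form metric_in_chart(1)[OF assms(1)])
  then show ?thesis by (rule dderiv_eqI)
qed

lemma linear_dderiv_metric:
  assumes "c \<in> N" "y \<in> coords c ` dom_chart c"
  shows "linear (\<lambda>a. dderiv (\<lambda>y'. G c y' a b) w y)" "linear (\<lambda>b. dderiv (\<lambda>y'. G c y' a b) w y)"
    "linear (\<lambda>w. dderiv (\<lambda>y'. G c y' a b) w y)"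
proof -
  have 1: "(\<lambda>a. dderiv (\<lambda>y'. G c y' a b) w y) = (\<lambda>a. quad_form (\<lambda>i j. dderiv (\<lambda>y'. G c y' i j) w y) a b)"
    by (rule ext) (rule dderiv_metric_quad_form[OF assms])
  show "linear (\<lambda>a. dderiv (\<lambda>y'. G c y' a b) w y)"
    by (subst 1) (rule linear_quad_form)
  have 2: "(\<lambda>b. dderiv (\<lambda>y'. G c y' a b) w y) = quad_form (\<lambda>i j. dderiv (\<lambda>y'. G c y' i j) w y) a"
    by (rule ext) (rule dderiv_metric_quad_form[OF assms])
  show "linear (\<lambda>b. dderiv (\<lambda>y'. G c y' a b) w y)"
    by (subst 2) (rule linear_quad_form)
  show "linear (\<lambda>w. dderiv (\<lambda>y'. G c y' a b) w y)"
    by (rule linear_dderiv[OF smooth_onD(1)[OF smooth_metric[OF assms(1)] assms(2)]])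
qed

lemma linear_koszul:
  assumes "c \<in> N" "y \<in> coords c ` dom_chart c"
  shows "linear (\<lambda>u. koszul c y u v w)" "linear (\<lambda>v. koszul c y u v w)" "linear (koszul c y u v)"
  unfolding koszul_def by (intro linear_compose_add linear_compose_sub linear_dderiv_metric assms)+

lemma christoffel_ex1:
  assumes "c \<in> N" "y \<in> coords c ` dom_chart c"
  shows "\<exists>!z. \<forall>w. 2 * G c y z w = koszul c y u v w"
proof -
  have "\<exists>!z. \<forall>w. G c y z w = koszul c y u v w / 2"
    by (rule posdef_bilinear_representation[OF metric_in_chart[OF assms]])
      (auto intro!: linearI simp: linear_add[OF linear_koszul(3)[OF assms]] linear_cmul[OF linear_koszul(3)[OF assms]] add_divide_distrib)
  then show ?thesis by (simp add: field_simps)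
qed

text \<open>The definite description in the definition is meaningful because the metric is definite. Uniqueness,
  the second part, is the tool for deriving the algebraic properties of the Christoffel form.\<close>
lemma christoffel:
  assumes "c \<in> N" "y \<in> coords c ` dom_chart c"
  shows "2 * G c y (christoffel N g c y u v) w = koszul c y u v w"
    and "(\<And>w. 2 * G c y z w = koszul c y u v w) \<Longrightarrow> z = christoffel N g c y u v"
proof -
  have c: "christoffel N g c y u v = (THE z. \<forall>w. 2 * G c y z w = koszul c y u v w)"
    by (simp add: christoffel_def koszul_def Let_def)
  show *: "2 * G c y (christoffel N g c y u v) w = koszul c y u v w" for w
    using theI'[OF christoffel_ex1[OF assms, of u v]] unfolding c by blast
  show "z = christoffel N g c y u v" if "\<And>w. 2 * G c y z w = koszul c y u v w"
    using that * christoffel_ex1[OF assms, of u v] by metis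
qed

lemma bilinear_christoffel:
  assumes "c \<in> N" "y \<in> coords c ` dom_chart c"
  shows "bilinear (christoffel N g c y)"
proof -
  note K1 = linear_add[OF linear_koszul(1)[OF assms]] linear_cmul[OF linear_koszul(1)[OF assms]]
  note K2 = linear_add[OF linear_koszul(2)[OF assms]] linear_cmul[OF linear_koszul(2)[OF assms]]
  have "linear (\<lambda>z. G c y z w)" for w using metric_in_chart(1)[OF assms] by (auto simp: bilinear_def)
  note L = linear_add[OF this] linear_cmul[OF this]
  note C = christoffel(1)[OF assms]
  show ?thesis unfolding bilinear_def
    by (intro conjI allI linearI; rule christoffel(2)[OF assms, symmetric])
      (simp_all add: L K1 K2 distrib_left C mult.left_commute[of 2])
qed

text \<open>The components of the Christoffel form solve a linear system whose matrix (the metric) and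
  right-hand side (first derivatives of the metric) are smooth, and the matrix is definite.\<close>
lemma lipschitz_at_christoffel:
  assumes "c \<in> N" "y \<in> coords c ` dom_chart c"
  shows "lipschitz_at (\<lambda>y. christoffel N g c y u v) y"
proof (rule lipschitz_at_linear_system_solution[where k = "\<lambda>a b y. G c y a b" and r = "\<lambda>b y. (1/2) *\<^sub>R koszul c y u v b"])
  note sm = smooth_on_lipschitz_at[OF open_range[OF assms(1)] _ assms(2)]
  show "lipschitz_at (\<lambda>y. G c y a b) y" for a b by (rule sm[OF smooth_metric[OF assms(1)]])
  show "lipschitz_at (\<lambda>y. (1/2) *\<^sub>R koszul c y u v b) y" for b
  proof -
    have "lipschitz_at (\<lambda>y. (1/2) *\<^sub>R (dderiv (\<lambda>y'. G c y' v b) u y + dderiv (\<lambda>y'. G c y' u b) v y + (-1) *\<^sub>R dderiv (\<lambda>y'. G c y' u v) b y)) y"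
      by (intro lipschitz_at_scaleR lipschitz_at_add lipschitz_at_const sm smooth_onD(2) smooth_metric assms)
    then show ?thesis by (simp add: koszul_def)
  qed
  show "quad_form (\<lambda>a b. G c y a b) s s > 0" if "s \<noteq> 0" for s
    using metric_in_chart[OF assms] that bilinear_eq_quad_form[of "G c y"] by metis
  have "\<forall>\<^sub>F y in nhds y. y \<in> coords c ` dom_chart c"
    using open_range[OF assms(1)] assms(2) eventually_nhds_in_open by blast
  then show "\<forall>\<^sub>F y in nhds y. \<forall>w. quad_form (\<lambda>a b. G c y a b) (christoffel N g c y u v) w
      = (\<Sum>b\<in>Basis. (w \<bullet> b) * (1/2) *\<^sub>R koszul c y u v b)"
  proof (eventually_elim, intro allI)
    fix y w assume y: "y \<in> coords c ` dom_chart c"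
    have "koszul c y u v w = (\<Sum>b\<in>Basis. (w \<bullet> b) *\<^sub>R koszul c y u v b)"
      by (rule linear_Basis_sum[OF linear_koszul(3)[OF assms(1) y]])
    then show "quad_form (\<lambda>a b. G c y a b) (christoffel N g c y u v) w
      = (\<Sum>b\<in>Basis. (w \<bullet> b) * (1/2) *\<^sub>R koszul c y u v b)"
      using christoffel(1)[OF assms(1) y, of u v w]
        bilinear_eq_quad_form[OF metric_in_chart(1)[OF assms(1) y], of "christoffel N g c y u v" w]
      by (simp add: sum_divide_distrib[symmetric])
  qed
qed

text \<open>The vector field on position-velocity pairs whose integral curves are the geodesics.\<close>
definition spray where "spray c = (\<lambda>(y, v). (v, - christoffel N g c y v v))"

lemma lipschitz_at_spray:
  assumes "c \<in> N" "y \<in> coords c ` dom_chart c"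
  shows "lipschitz_at (spray c) (y, v)"
proof -
  have lin: "lipschitz_at (\<lambda>p. snd p \<bullet> b) (y, v)" "lipschitz_at snd (y, v)" for b
    by (intro lipschitz_at_bounded_linear bounded_linear_compose[OF bounded_linear_inner_left bounded_linear_snd] bounded_linear_snd)+
  have c: "lipschitz_at (\<lambda>p. christoffel N g c (fst p) a b) (y, v)" for a b
    by (rule lipschitz_at_compose) (auto intro: lipschitz_at_christoffel[OF assms] lipschitz_at_bounded_linear bounded_linear_fst)
  have l: "lipschitz_at (\<lambda>p. (snd p, (-1) *\<^sub>R (\<Sum>a\<in>Basis. \<Sum>b\<in>Basis. (snd p \<bullet> a) *\<^sub>R (snd p \<bullet> b) *\<^sub>R christoffel N g c (fst p) a b))) (y, v)"
    by (intro lipschitz_at_Pair lipschitz_at_scaleR lipschitz_at_sum lipschitz_at_const finite_Basis lin c)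
  have eq: "spray c p = (snd p, (-1) *\<^sub>R (\<Sum>a\<in>Basis. \<Sum>b\<in>Basis. (snd p \<bullet> a) *\<^sub>R (snd p \<bullet> b) *\<^sub>R christoffel N g c (fst p) a b))"
    if "fst p \<in> coords c ` dom_chart c" for p
  proof -
    define v where "v = snd p"
    have l1: "linear (\<lambda>u. christoffel N g c (fst p) u v)" and l2: "linear (christoffel N g c (fst p) u)" for u v
      using bilinear_christoffel[OF assms(1) that] by (auto simp: bilinear_def)
    have "christoffel N g c (fst p) v v = (\<Sum>a\<in>Basis. (v \<bullet> a) *\<^sub>R christoffel N g c (fst p) a v)"
      by (rule linear_Basis_sum[OF l1])
    also have "\<dots> = (\<Sum>a\<in>Basis. (v \<bullet> a) *\<^sub>R (\<Sum>b\<in>Basis. (v \<bullet> b) *\<^sub>R christoffel N g c (fst p) a b))"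
      by (intro sum.cong refl arg_cong2[where f = scaleR] linear_Basis_sum[OF l2])
    finally have X: "christoffel N g c (fst p) v v = (\<Sum>a\<in>Basis. \<Sum>b\<in>Basis. (v \<bullet> a) *\<^sub>R (v \<bullet> b) *\<^sub>R christoffel N g c (fst p) a b)"
      by (simp only: scaleR_sum_right)
    show ?thesis
      unfolding spray_def case_prod_beta scaleR_minus1_left X[unfolded v_def] by (rule refl)
  qed
  have "\<forall>\<^sub>F y in nhds y. y \<in> coords c ` dom_chart c"
    using open_range[OF assms(1)] assms(2) eventually_nhds_in_open by blast
  then have "\<forall>\<^sub>F p in nhds (y, v). fst p \<in> coords c ` dom_chart c"
    by (rule eventually_compose_filterlim[OF _ tendsto_nhds_fst_snd(1)])
  note ev = eventually_compose_filterlim[OF this tendsto_nhds_fst_snd(1)]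
    eventually_compose_filterlim[OF this tendsto_nhds_fst_snd(2)]
  obtain L where L: "L \<ge> 0" "\<forall>\<^sub>F q in nhds ((y, v), (y, v)). 
      norm ((\<lambda>p. (snd p, (-1) *\<^sub>R (\<Sum>a\<in>Basis. \<Sum>b\<in>Basis. (snd p \<bullet> a) *\<^sub>R (snd p \<bullet> b) *\<^sub>R christoffel N g c (fst p) a b))) (fst q)
       - (\<lambda>p. (snd p, (-1) *\<^sub>R (\<Sum>a\<in>Basis. \<Sum>b\<in>Basis. (snd p \<bullet> a) *\<^sub>R (snd p \<bullet> b) *\<^sub>R christoffel N g c (fst p) a b))) (snd q))
      \<le> L * norm (fst q - snd q)"
    using l unfolding lipschitz_at_def by blast
  have "\<forall>\<^sub>F q in nhds ((y, v), (y, v)). norm (spray c (fst q) - spray c (snd q)) \<le> L * norm (fst q - snd q)"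
    using L(2) ev[of "(y, v)"]
  proof eventually_elim
    case (elim q)
    show ?case unfolding eq[OF elim(2)] eq[OF elim(3)] using elim(1) by simp
  qed
  then show ?thesis unfolding lipschitz_at_def using L(1) by blast
qed

section \<open>Uniqueness of geodesics and the exponential map\<close>

text \<open>The second-order geodesic equation as a first-order system for the coordinates and their
  velocity.\<close>
lemma geodesic_in_chart:
  assumes "geodesic N g \<gamma>" "c \<in> N" "\<gamma> t \<in> dom_chart c"
  defines "u \<equiv> \<lambda>s. coords c (\<gamma> s)"
  shows "(u has_vector_derivative dderiv u 1 t) (at t)" 
    "(dderiv u 1 has_vector_derivative - christoffel N g c (u t) (dderiv u 1 t) (dderiv u 1 t)) (at t)"
proof -
  have sm: "smooth_into N UNIV \<gamma>" using assms by (simp add: geodesic_def)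
  note o = smooth_into_chart(1)[OF sm open_UNIV assms(2)]
  note s = smooth_into_chart(2)[OF sm open_UNIV assms(2), folded u_def]
  have t: "t \<in> UNIV \<inter> \<gamma> -` dom_chart c" using assms by simp
  show "(u has_vector_derivative dderiv u 1 t) (at t)"
    by (rule smooth_curve_vector_derivative(1)[OF s t])
  have 2: "(dderiv u 1 has_vector_derivative dderiv (dderiv u 1) 1 t) (at t)"
    by (rule smooth_curve_vector_derivative(1)[OF smooth_onD(2)[OF s] t])
  have "\<forall>\<^sub>F s in nhds t. s \<in> UNIV \<inter> \<gamma> -` dom_chart c"
    using o t by (rule eventually_nhds_in_open)
  then have "\<forall>\<^sub>F s in nhds t. dderiv u 1 s = vector_derivative u (at s)"
    by eventually_elim (use smooth_curve_vector_derivative(2)[OF s] in auto)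
  from has_vector_derivative_eventually_eq[OF 2 this]
  have "vector_derivative (\<lambda>s. vector_derivative u (at s)) (at t) = dderiv (dderiv u 1) 1 t"
    by (rule vector_derivative_at)
  moreover have "vector_derivative (\<lambda>s. vector_derivative u (at s)) (at t)
     + christoffel N g c (u t) (vector_derivative u (at t)) (vector_derivative u (at t)) = 0"
    using assms by (simp add: geodesic_def Let_def o_def u_def)
  ultimately show "(dderiv u 1 has_vector_derivative - christoffel N g c (u t) (dderiv u 1 t) (dderiv u 1 t)) (at t)"
    using 2 smooth_curve_vector_derivative(2)[OF s t] by (simp add: add_eq_0_iff2)
qed

lemma geodesic_isCont: "geodesic N g \<gamma> \<Longrightarrow> isCont \<gamma> t"
  using smooth_into_chart(3)[OF _ open_UNIV chart_at(1) UNIV_I] unfolding geodesic_def by blast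

lemma geodesic_unique_locally:
  assumes "geodesic N g \<gamma>" "geodesic N g \<delta>" "c \<in> N" "\<gamma> t0 \<in> dom_chart c" "\<gamma> t0 = \<delta> t0"
    and "dderiv (\<lambda>s. coords c (\<gamma> s)) 1 t0 = dderiv (\<lambda>s. coords c (\<delta> s)) 1 t0"
  shows "\<forall>\<^sub>F t in nhds t0. \<gamma> t = \<delta> t"
proof -
  define w where "w \<gamma> t = (coords c (\<gamma> t), dderiv (\<lambda>s. coords c (\<gamma> s)) 1 t)" for \<gamma> :: "real \<Rightarrow> 'a" and t
  have w: "(w \<gamma> has_vector_derivative spray c (w \<gamma> t)) (at t)" if "geodesic N g \<gamma>" "\<gamma> t \<in> dom_chart c" for \<gamma> t
    unfolding w_def spray_def prod.case
    by (intro has_vector_derivative_Pair geodesic_in_chart[OF that(1) assms(3) that(2)])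
  have ev: "\<forall>\<^sub>F t in nhds t0. \<gamma> t \<in> dom_chart c" "\<forall>\<^sub>F t in nhds t0. \<delta> t \<in> dom_chart c"
    using continuous_at_eventually_in[OF geodesic_isCont open_dom[OF assms(3)]] assms by auto
  have "\<forall>\<^sub>F t in nhds t0. w \<gamma> t = w \<delta> t"
  proof (rule ode_unique_locally[where X = "spray c"])
    show "lipschitz_at (spray c) (w \<gamma> t0)"
      unfolding w_def using assms by (intro lipschitz_at_spray) auto
    show "w \<gamma> t0 = w \<delta> t0" using assms by (simp add: w_def)
    show "\<forall>\<^sub>F t in nhds t0. (w \<gamma> has_vector_derivative spray c (w \<gamma> t)) (at t) \<and>
      (w \<delta> has_vector_derivative spray c (w \<delta> t)) (at t)"
      using ev by eventually_elim (use w assms in auto)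
  qed
  then show ?thesis using ev
  proof eventually_elim
    case (elim t)
    then show ?case using point_coords[OF assms(3)] by (metis w_def prod.inject)
  qed
qed

text \<open>The set \<open>A\<close> of times around which the two geodesics agree is open by definition. It is closed
  because position and velocity agree at a limit point by continuity, where local uniqueness applies
  again. Using germs instead of initial data in the definition of \<open>A\<close> makes the velocities agree in
  every chart at once.\<close>
lemma geodesic_unique:
  assumes "geodesic N g \<gamma>" "geodesic N g \<delta>" "\<gamma> 0 = \<delta> 0" "velocity N \<gamma> 0 = velocity N \<delta> 0"
  shows "\<gamma> = \<delta>"
proof -
  define A where "A = {t. \<forall>\<^sub>F s in nhds t. \<gamma> s = \<delta> s}"
  have sm: "smooth_into N UNIV \<gamma>" "smooth_into N UNIV \<delta>" using assms by (auto simp: geodesic_def)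
  have vd: "dderiv (\<lambda>s. coords c (\<gamma> s)) 1 t = vector_derivative (\<lambda>s. coords c (\<gamma> s)) (at t)"
    if "c \<in> N" "\<gamma> t \<in> dom_chart c" "smooth_into N UNIV \<gamma>" for c t and \<gamma> :: "real \<Rightarrow> 'a"
    using smooth_curve_vector_derivative(2)[OF smooth_into_chart(2)[OF that(3) open_UNIV that(1)]] that(2) by auto
  have "0 \<in> A" unfolding A_def
    using geodesic_unique_locally[OF assms(1,2) chart_at, of 0] assms(3,4) vd[OF chart_at(1) _ sm(1)]
      vd[OF chart_at(1) _ sm(2)] chart_at(2)
    by (simp add: velocity_def o_def)
  moreover have "open A"
  proof (subst open_subopen, intro ballI)
    fix t assume "t \<in> A"
    then have "\<forall>\<^sub>F s in nhds t. \<forall>\<^sub>F r in nhds s. \<gamma> r = \<delta> r" by (simp add: A_def eventually_eventually)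
    then show "\<exists>T. open T \<and> t \<in> T \<and> T \<subseteq> A" by (auto simp: A_def eventually_nhds)
  qed
  moreover have "closed A"
  proof (subst closed_limpt, intro allI impI)
    fix t assume t: "t islimpt A"
    define c where "c = chart_at N (\<gamma> t)"
    have eqA: "\<gamma> s = \<delta> s" if "s \<in> A" for s using that eventually_nhds_x_imp_x by (auto simp: A_def)
    have e: "\<gamma> t = \<delta> t"
      using isCont_eq_at_limit[OF geodesic_isCont[OF assms(1)] geodesic_isCont[OF assms(2)] t] eqA by blast
    have c: "c \<in> N" "\<gamma> t \<in> dom_chart c" "\<delta> t \<in> dom_chart c" using chart_at e by (auto simp: c_def)
    have cont: "isCont (dderiv (\<lambda>s. coords c (\<gamma> s)) 1) t" if "geodesic N g \<gamma>" "\<gamma> t \<in> dom_chart c" for \<gamma>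
      using geodesic_in_chart(2)[OF that(1) c(1) that(2)] has_vector_derivative_continuous by blast
    have "dderiv (\<lambda>s. coords c (\<gamma> s)) 1 s = dderiv (\<lambda>s. coords c (\<delta> s)) 1 s" if "s \<in> A" for s
    proof -
      have "\<forall>\<^sub>F r in nhds s. \<gamma> r = \<delta> r" using that by (simp add: A_def)
      then obtain T where "open T" "s \<in> T" "\<And>r. r \<in> T \<Longrightarrow> \<gamma> r = \<delta> r" by (auto simp: eventually_nhds)
      then show ?thesis by (intro dderiv_cong_open[of T]) auto
    qed
    then have "dderiv (\<lambda>s. coords c (\<gamma> s)) 1 t = dderiv (\<lambda>s. coords c (\<delta> s)) 1 t"
      using isCont_eq_at_limit[OF cont[OF assms(1) c(2)] cont[OF assms(2) c(3)] t] by blast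
    then show "t \<in> A" unfolding A_def
      using geodesic_unique_locally[OF assms(1,2) c(1,2) e] by simp
  qed
  ultimately have "A = UNIV" using clopen[of A] by auto
  then show ?thesis using eventually_nhds_x_imp_x by (fastforce simp: A_def)
qed

lemma riem_exp_eq:
  assumes "geodesic N g \<gamma>"
  shows "riem_exp N g (\<gamma> 0) (velocity N \<gamma> 0) = \<gamma> 1"
  unfolding riem_exp_def
  by (rule the_equality) (use assms geodesic_unique in blast)+

lemma geodesic_rescale:
  assumes "geodesic N g \<gamma>"
  shows "geodesic N g (\<lambda>s. \<gamma> (a * s))" "velocity N (\<lambda>s. \<gamma> (a * s)) 0 = a *\<^sub>R velocity N \<gamma> 0"
proof -
  have sm: "smooth_into N UNIV \<gamma>" using assms by (simp add: geodesic_def)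
  have cont: "continuous_on UNIV \<gamma>" using sm by (simp add: smooth_into_def)
  have bl: "bounded_linear (\<lambda>s. a * s)" by (rule bounded_linear_mult_right)
  have cont': "continuous_on UNIV (\<lambda>s. \<gamma> (a * s))"
    by (rule continuous_on_compose2[OF cont]) (auto intro!: continuous_intros)
  have op: "open ((\<lambda>s. \<gamma> (a * s)) -` dom_chart c)" if "c \<in> N" for c
    using open_vimage[OF open_dom[OF that] cont'] .
  have 1: "((\<lambda>s. f (a * s)) has_vector_derivative a *\<^sub>R f') (at t)"
    if "(f has_vector_derivative f') (at (a * t))" for f :: "real \<Rightarrow> 'b" and f' t
    using vector_derivative_diff_chain_within[of "\<lambda>s. a * s" a t UNIV f "\<lambda>h. h *\<^sub>R f'"] that
      bounded_linear.has_vector_derivative[OF bl has_vector_derivative_id[of "at t"]]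
    by (auto simp: o_def has_vector_derivative_def intro: has_derivative_at_withinI)
  have d1: "((\<lambda>s. coords c (\<gamma> (a * s))) has_vector_derivative a *\<^sub>R dderiv (\<lambda>s. coords c (\<gamma> s)) 1 (a * t)) (at t)"
    if "c \<in> N" "\<gamma> (a * t) \<in> dom_chart c" for c t
    by (rule 1[OF geodesic_in_chart(1)[OF assms that]])
  show "geodesic N g (\<lambda>s. \<gamma> (a * s))" unfolding geodesic_def
  proof (intro conjI ballI allI impI)
    show "smooth_into N UNIV (\<lambda>s. \<gamma> (a * s))" unfolding smooth_into_def
    proof (intro conjI ballI cont')
      fix c assume c: "c \<in> N"
      have "smooth_on ((\<lambda>s. \<gamma> (a * s)) -` dom_chart c) (\<lambda>s. coords c (\<gamma> (0 + a * s)))"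
        by (rule smooth_on_compose[OF op[OF c] _ smooth_on_affine[OF op[OF c] bl] smooth_into_chart(2)[OF sm open_UNIV c]]) auto
      then show "smooth_on (UNIV \<inter> (\<lambda>s. \<gamma> (a * s)) -` dom_chart c) (coords c \<circ> (\<lambda>s. \<gamma> (a * s)))"
        by (simp add: o_def)
    qed
    fix c t assume c: "c \<in> N" "\<gamma> (a * t) \<in> dom_chart c"
    define u where "u = (\<lambda>s. coords c (\<gamma> s))"
    have "\<forall>\<^sub>F s in nhds t. s \<in> (\<lambda>s. \<gamma> (a * s)) -` dom_chart c"
      using op[OF c(1)] c(2) by (intro eventually_nhds_in_open) auto
    then have "\<forall>\<^sub>F s in nhds t. a *\<^sub>R dderiv u 1 (a * s) = vector_derivative (\<lambda>s. coords c (\<gamma> (a * s))) (at s)"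
    proof eventually_elim
      case (elim s)
      then show ?case using vector_derivative_at[OF d1[OF c(1)]] by (simp add: u_def)
    qed
    note ev = this
    have "((\<lambda>s. a *\<^sub>R dderiv u 1 (a * s)) has_vector_derivative
       a *\<^sub>R a *\<^sub>R (- christoffel N g c (u (a * t)) (dderiv u 1 (a * t)) (dderiv u 1 (a * t)))) (at t)"
      using geodesic_in_chart(2)[OF assms c]
      by (intro bounded_linear.has_vector_derivative[OF bounded_linear_scaleR_right] 1) (simp add: u_def)
    from vector_derivative_at[OF has_vector_derivative_eventually_eq[OF this ev]]
    have A: "vector_derivative (\<lambda>s. vector_derivative (\<lambda>s. coords c (\<gamma> (a * s))) (at s)) (at t)
      = a *\<^sub>R a *\<^sub>R (- christoffel N g c (u (a * t)) (dderiv u 1 (a * t)) (dderiv u 1 (a * t)))" .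
    have "u (a * t) \<in> coords c ` dom_chart c" using c by (simp add: u_def)
    note B = bilinear_christoffel[OF c(1) this]
    have "christoffel N g c (u (a * t)) (a *\<^sub>R v) (a *\<^sub>R v) = a *\<^sub>R a *\<^sub>R christoffel N g c (u (a * t)) v v" for v
      by (simp add: bilinear_lmul[OF B] bilinear_rmul[OF B])
    then show "let v = \<lambda>s. vector_derivative (coords c \<circ> (\<lambda>s. \<gamma> (a * s))) (at s)
         in vector_derivative v (at t) + christoffel N g c (coords c (\<gamma> (a * t))) (v t) (v t) = 0"
      using A eventually_nhds_x_imp_x[OF ev, symmetric] by (simp add: Let_def o_def u_def)
  qed
  show "velocity N (\<lambda>s. \<gamma> (a * s)) 0 = a *\<^sub>R velocity N \<gamma> 0"
    unfolding velocity_def o_def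
    using vector_derivative_at[OF d1[OF chart_at(1), of 0]] chart_at(2)[of "\<gamma> 0"]
      vector_derivative_at[OF geodesic_in_chart(1)[OF assms chart_at(1), of 0]] by simp
qed

text \<open>The ray \<open>t \<mapsto> t v\<close> is mapped to the geodesic with initial velocity \<open>v\<close>.\<close>
lemma riem_exp_scaleR:
  assumes "geodesic N g \<gamma>"
  shows "riem_exp N g (\<gamma> 0) (a *\<^sub>R velocity N \<gamma> 0) = \<gamma> a"
  using riem_exp_eq[OF geodesic_rescale(1)[OF assms, of a]] geodesic_rescale(2)[OF assms, of a] by simp

end

section \<open>Submanifolds in slice charts\<close>

text \<open>The difference quotients lie in the subspace, which is closed.\<close>
lemma vector_derivative_in_subspace:
  fixes u :: "real \<Rightarrow> 'b::euclidean_space"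
  assumes "(u has_vector_derivative v) (at t)" "subspace S" "\<forall>\<^sub>F s in nhds t. u s \<in> S"
  shows "v \<in> S"
proof (rule Lim_in_closed_set[OF closed_subspace[OF assms(2)]])
  show "((\<lambda>s. (1 / (s - t)) *\<^sub>R (u s - u t)) \<longlongrightarrow> v) (at t)"
  proof -
    have "((\<lambda>s. (1 / norm (s - t)) *\<^sub>R (u s - (u t + (s - t) *\<^sub>R v))) \<longlongrightarrow> 0) (at t)"
      using assms(1) unfolding has_vector_derivative_def has_derivative_within by blast
    then have "((\<lambda>s. norm ((1 / norm (s - t)) *\<^sub>R (u s - (u t + (s - t) *\<^sub>R v)))) \<longlongrightarrow> 0) (at t)"
      by (rule tendsto_norm_zero)
    moreover have "\<forall>\<^sub>F s in at t. norm ((1 / norm (s - t)) *\<^sub>R (u s - (u t + (s - t) *\<^sub>R v)))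
       = norm ((1 / (s - t)) *\<^sub>R (u s - u t) - v)"
      unfolding eventually_at_filter
    proof (intro always_eventually allI impI)
      fix s assume "s \<noteq> t"
      then have "(1 / (s - t)) *\<^sub>R (u s - u t) - v = (1 / (s - t)) *\<^sub>R (u s - (u t + (s - t) *\<^sub>R v))"
        unfolding diff_diff_eq[symmetric] scaleR_diff_right[of _ "u s - u t"] by simp
      then show "norm ((1 / norm (s - t)) *\<^sub>R (u s - (u t + (s - t) *\<^sub>R v))) = norm ((1 / (s - t)) *\<^sub>R (u s - u t) - v)"
        by simp
    qed
    ultimately have "((\<lambda>s. norm ((1 / (s - t)) *\<^sub>R (u s - u t) - v)) \<longlongrightarrow> 0) (at t)"
      by (rule Lim_transform_eventually)
    then show ?thesis by (rule LIM_zero_cancel[OF tendsto_norm_zero_cancel])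
  qed
  have "u t \<in> S" using eventually_nhds_x_imp_x[OF assms(3)] .
  moreover have "\<forall>\<^sub>F s in at t. u s \<in> S" using assms(3) by (auto simp: eventually_at_filter elim: eventually_mono)
  ultimately show "\<forall>\<^sub>F s in at t. (1 / (s - t)) *\<^sub>R (u s - u t) \<in> S"
    using assms(2) by (auto elim!: eventually_mono intro: subspace_scale subspace_diff)
qed simp

lemma has_vector_derivative_line: "((\<lambda>t. a + t *\<^sub>R s) has_vector_derivative s) (at t)"
  using has_vector_derivative_add[OF has_vector_derivative_const[of a]
      has_vector_derivative_scaleR[OF DERIV_ident has_vector_derivative_const[of s]], of t] by simp

lemma eventually_line_in_open:
  fixes a s :: "'a::real_normed_vector"
  assumes "open W" "a + t *\<^sub>R s \<in> W"
  shows "\<forall>\<^sub>F r in nhds t. a + r *\<^sub>R s \<in> W"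
  using continuous_at_eventually_in[OF has_vector_derivative_continuous[OF has_vector_derivative_line] assms] .

locale slice_chart = riemannian +
  fixes M d S
  assumes d: "d \<in> N" and S: "subspace S" 
    and slice: "coords d ` (M \<inter> dom_chart d) = coords d ` dom_chart d \<inter> S"
begin

lemma mem_iff_slice: assumes "p \<in> dom_chart d" shows "p \<in> M \<longleftrightarrow> coords d p \<in> S"
proof
  assume "p \<in> M" then show "coords d p \<in> S" using slice assms by blast
next
  assume "coords d p \<in> S"
  then have "coords d p \<in> coords d ` (M \<inter> dom_chart d)" using slice assms by blast
  then obtain q where "q \<in> M" "q \<in> dom_chart d" "coords d p = coords d q" by blast
  then show "p \<in> M" using point_coords[OF d] assms by metis
qed

text \<open>In a slice chart a curve in \<open>M\<close> stays in \<open>S\<close>, and so does its velocity; conversely a straight line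
  in \<open>S\<close> realises each direction.\<close>
lemma tangent_space_eq:
  assumes p: "p \<in> M" "p \<in> dom_chart d"
  shows "tangent_space N M p = coord_change d (chart_at N p) p ` S"
proof
  show "tangent_space N M p \<subseteq> coord_change d (chart_at N p) p ` S"
  proof
    fix X assume "X \<in> tangent_space N M p"
    then obtain \<gamma> \<epsilon> where g: "X = velocity N \<gamma> 0" "\<epsilon> > 0" "smooth_into N {-\<epsilon><..<\<epsilon>} \<gamma>"
      "\<gamma> ` {-\<epsilon><..<\<epsilon>} \<subseteq> M" "\<gamma> 0 = p" by (auto simp: tangent_space_def)
    note 1 = smooth_into_chart[OF g(3) open_greaterThanLessThan d]
    have 0: "0 \<in> {-\<epsilon><..<\<epsilon>} \<inter> \<gamma> -` dom_chart d" using g p by auto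
    have "\<forall>\<^sub>F t in nhds 0. coords d (\<gamma> t) \<in> S"
      using eventually_nhds_in_open[OF 1(1) 0]
    proof eventually_elim
      case (elim t)
      then have "\<gamma> t \<in> M" "\<gamma> t \<in> dom_chart d" using g(4) by auto
      then show ?case using mem_iff_slice by blast
    qed
    from vector_derivative_in_subspace[OF smooth_curve_vector_derivative(1)[OF 1(2) 0] S this]
    have "dderiv (\<lambda>t. coords d (\<gamma> t)) 1 0 \<in> S" .
    moreover have "X = coord_change d (chart_at N p) p (dderiv (\<lambda>t. coords d (\<gamma> t)) 1 0)"
      using velocity_in_chart[OF g(3) open_greaterThanLessThan _ d, of 0] g p by simp
    ultimately show "X \<in> coord_change d (chart_at N p) p ` S" by blast
  qed
  show "coord_change d (chart_at N p) p ` S \<subseteq> tangent_space N M p"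
  proof
    fix X assume "X \<in> coord_change d (chart_at N p) p ` S"
    then obtain s where s: "s \<in> S" "X = coord_change d (chart_at N p) p s" by blast
    define y where "y t = coords d p + t *\<^sub>R s" for t
    define \<gamma> where "\<gamma> t = point d (y t)" for t
    have "\<forall>\<^sub>F t in nhds 0. y t \<in> coords d ` dom_chart d"
      unfolding y_def by (rule eventually_line_in_open[OF open_range[OF d]]) (use p in simp)
    then obtain \<epsilon> where e: "\<epsilon> > 0" "\<And>t. dist t 0 < \<epsilon> \<Longrightarrow> y t \<in> coords d ` dom_chart d"
      unfolding eventually_nhds_metric by blast
    define I where "I = {-\<epsilon><..<\<epsilon>}"
    have I: "open I" "0 \<in> I" "\<And>t. t \<in> I \<Longrightarrow> y t \<in> coords d ` dom_chart d"
      using e by (auto simp: I_def)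
    have gd: "\<gamma> t \<in> dom_chart d" "coords d (\<gamma> t) = y t" if "t \<in> I" for t
      using I(3)[OF that] d by (auto simp: \<gamma>_def)
    have yS: "y t \<in> S" for t
      using mem_iff_slice[OF p(2)] p(1) s(1) S by (auto simp: y_def intro: subspace_add subspace_scale)
    have bl: "bounded_linear (\<lambda>t. t *\<^sub>R s)" by (rule bounded_linear_scaleR_left)
    have cont: "continuous_on I \<gamma>" unfolding \<gamma>_def
      by (rule continuous_on_compose2[OF continuous_on_point[OF d]]) (use I in \<open>auto simp: y_def intro!: continuous_intros\<close>)
    have sm: "smooth_into N I \<gamma>" unfolding smooth_into_def
    proof (intro conjI ballI cont)
      fix c assume c: "c \<in> N"
      have "open (\<gamma> -` dom_chart c \<inter> I)" 
        using cont open_dom[OF c] by (simp only: continuous_on_open_vimage[OF I(1)])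
      then have op: "open (I \<inter> \<gamma> -` dom_chart c)" by (simp add: inf_commute)
      have "smooth_on (I \<inter> \<gamma> -` dom_chart c) (\<lambda>t. coords c (point d (coords d p + t *\<^sub>R s)))"
      proof (rule smooth_on_compose[OF op _ smooth_on_affine[OF op bl] smooth_transition[OF d c]])
        show "(\<lambda>t. coords d p + t *\<^sub>R s) ` (I \<inter> \<gamma> -` dom_chart c) \<subseteq> coords d ` (dom_chart d \<inter> dom_chart c)"
        proof
          fix z assume "z \<in> (\<lambda>t. coords d p + t *\<^sub>R s) ` (I \<inter> \<gamma> -` dom_chart c)"
          then obtain t where "t \<in> I" "\<gamma> t \<in> dom_chart c" "z = y t" by (auto simp: y_def)
          then show "z \<in> coords d ` (dom_chart d \<inter> dom_chart c)" using gd[of t] by (metis IntI imageI)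
        qed
      qed
      then show "smooth_on (I \<inter> \<gamma> -` dom_chart c) (coords c \<circ> \<gamma>)"
        by (simp add: o_def \<gamma>_def y_def)
    qed
    have M: "\<gamma> ` I \<subseteq> M" using gd yS mem_iff_slice by force
    have 0: "\<gamma> 0 = p" using p d by (simp add: \<gamma>_def y_def)
    have "((\<lambda>t. coords d (\<gamma> t)) has_vector_derivative s) (at 0)"
    proof (rule has_vector_derivative_eventually_eq[OF has_vector_derivative_line])
      show "\<forall>\<^sub>F t in nhds 0. coords d p + t *\<^sub>R s = coords d (\<gamma> t)"
        using eventually_nhds_in_open[OF I(1,2)] by eventually_elim (simp add: gd y_def)
    qed
    then have "dderiv (\<lambda>t. coords d (\<gamma> t)) 1 0 = s"
      by (auto simp: has_vector_derivative_def dest: dderiv_eqI[where v = 1])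
    then have "velocity N \<gamma> 0 = X"
      using velocity_in_chart[OF sm I(1,2) d] 0 p s by simp
    then show "X \<in> tangent_space N M p"
      using e sm M 0 unfolding tangent_space_def I_def by blast
  qed
qed

lemma subspace_tangent_space:
  assumes p: "p \<in> M" "p \<in> dom_chart d"
  shows "subspace (tangent_space N M p)"
  unfolding tangent_space_eq[OF p]
  by (intro linear_subspace_image S linear_coord_change d chart_at p)

lemma normal_part:
  assumes p: "p \<in> M" "p \<in> dom_chart d"
  shows "X \<in> tangent_space N M p \<Longrightarrow> g p (normal_part N g M p z) X = 0"
    "z - normal_part N g M p z \<in> tangent_space N M p"
  using theI'[OF posdef_bilinear_orthogonal_projection[OF metric(1,3) subspace_tangent_space[OF p], of p z]]
  unfolding normal_part_def by auto

text \<open>This holds whatever field the choice operator in the definition picks, because the normal part of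
  any vector is normal. The mean curvature vector, a linear combination of such values, is therefore
  normal too.\<close>
lemma second_fundamental_form_normal:
  assumes p: "p \<in> M" "p \<in> dom_chart d" and "Z \<in> tangent_space N M p"
  shows "g p (second_fundamental_form N g M p X Y) Z = 0"
  unfolding second_fundamental_form_def by (rule normal_part(1)[OF assms])

lemma mean_curvature_normal:
  assumes p: "p \<in> M" "p \<in> dom_chart d" and "Z \<in> tangent_space N M p"
  shows "g p (mean_curvature N g M p) Z = 0"
proof -
  have lin: "linear (\<lambda>w. g p w Z)" using metric(1)[of p] by (auto simp: bilinear_def)
  show ?thesis unfolding mean_curvature_def Let_def
    by (simp only: linear_cmul[OF lin] linear_sum[OF lin] second_fundamental_form_normal[OF assms]) simp
qed

text \<open>The field with constant components \<open>s\<close> in the slice chart shows that the fields over which the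
  second fundamental form chooses exist.\<close>
lemma constant_slice_field:
  assumes "s \<in> S"
  defines "Z \<equiv> \<lambda>p. coord_change d (chart_at N p) p s"
  shows "smooth_field N (dom_chart d) Z" "p \<in> M \<inter> dom_chart d \<Longrightarrow> Z p \<in> tangent_space N M p"
proof -
  show "Z p \<in> tangent_space N M p" if "p \<in> M \<inter> dom_chart d"
    using that tangent_space_eq[of p] assms by auto
  show "smooth_field N (dom_chart d) Z" unfolding smooth_field_def
  proof
    fix c assume c: "c \<in> N"
    let ?W = "coords c ` (dom_chart c \<inter> dom_chart d)"
    have "smooth_on ?W (\<lambda>y. dderiv (\<lambda>z. coords c (point d z)) s (coords d (point c y)))"
      by (rule smooth_on_compose[OF open_overlap[OF c d] _ smooth_transition[OF c d]
            smooth_onD(2)[OF smooth_transition[OF d c]]]) (use c d in auto)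
    then have "smooth_on ?W (field_in_chart N Z c)"
    proof (rule smooth_on_cong[OF open_overlap[OF c d], rotated])
      fix y assume "y \<in> ?W"
      then obtain p where p: "y = coords c p" "p \<in> dom_chart c" "p \<in> dom_chart d" by auto
      have "field_in_chart N Z c y = coord_change d c p s"
        using p c d chart_at by (simp add: field_in_chart_def Z_def coord_change_compose)
      then show "dderiv (\<lambda>z. coords c (point d z)) s (coords d (point c y)) = field_in_chart N Z c y"
        using p c by (simp add: coord_change_eq_dderiv)
    qed
    then show "smooth_on (coords c ` (dom_chart d \<inter> dom_chart c)) (field_in_chart N Z c)"
      by (simp add: inf_commute)
  qed
qed

text \<open>The covariant acceleration at \<open>p\<close> of the curve in \<open>M\<close> that is the straight line in direction \<open>s\<close> in
  the slice chart, expressed in the chart at \<open>p\<close>.\<close>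
definition slice_acceleration where
  "slice_acceleration p s =
     (let \<tau> = (\<lambda>y. coords (chart_at N p) (point d y)); X = coord_change d (chart_at N p) p s
      in dderiv (dderiv \<tau> s) s (coords d p) + christoffel N g (chart_at N p) (coords (chart_at N p) p) X X)"

text \<open>In the slice chart the components \<open>\<zeta>\<close> of \<open>Z\<close> lie in \<open>S\<close> along \<open>M\<close>, hence so does their
  derivative \<open>\<zeta>'\<close> in the direction \<open>s\<close>. The components in the other chart are \<open>d\<tau>(\<zeta>)\<close>, whose
  derivative is \<open>d\<^sup>2\<tau>(s,s) + d\<tau>(\<zeta>')\<close>; the last term is tangent to \<open>M\<close>. This also shows that the
  second fundamental form does not depend on the chosen extension.\<close>
lemma cov_deriv_tangent_field:
  assumes p: "p \<in> M" "p \<in> dom_chart d" and s: "s \<in> S"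
    and U: "open U" "p \<in> U" and Z: "smooth_field N U Z" "\<And>q. q \<in> M \<inter> U \<Longrightarrow> Z q \<in> tangent_space N M q"
    and Zp: "Z p = coord_change d (chart_at N p) p s"
  shows "cov_deriv N g p (coord_change d (chart_at N p) p s) Z - slice_acceleration p s \<in> tangent_space N M p"
proof -
  define c where "c = chart_at N p"
  define X where "X = coord_change d c p s"
  have c: "c \<in> N" "p \<in> dom_chart c" using chart_at by (auto simp: c_def)
  define \<tau> where "\<tau> = (\<lambda>y. coords c (point d y))"
  let ?O = "coords d ` (dom_chart d \<inter> dom_chart c)"
  have \<tau>: "smooth_on ?O \<tau>" "open ?O" unfolding \<tau>_def using smooth_transition open_overlap c d by auto
  define y where "y t = coords d p + t *\<^sub>R s" for t
  define \<zeta> where "\<zeta> = field_in_chart N Z d"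
  let ?W = "coords d ` (U \<inter> dom_chart d)"
  have W: "open ?W" by (rule open_coords_image[OF d U(1)])
  have \<zeta>: "smooth_on ?W \<zeta>" using Z(1) d by (simp add: \<zeta>_def smooth_field_def)
  have \<zeta>S: "\<zeta> (coords d q) \<in> S" "q \<in> dom_chart e \<Longrightarrow> e \<in> N \<Longrightarrow> field_in_chart N Z e (coords e q) = coord_change d e q (\<zeta> (coords d q))"
    if q: "q \<in> M \<inter> U" "q \<in> dom_chart d" for q e
  proof -
    obtain r where r: "r \<in> S" "Z q = coord_change d (chart_at N q) q r"
      using Z(2)[OF q(1)] tangent_space_eq[of q] q by auto
    have "\<zeta> (coords d q) = r"
      using q d r chart_at by (simp add: \<zeta>_def field_in_chart_def coord_change_inverse)
    then show "\<zeta> (coords d q) \<in> S" "q \<in> dom_chart e \<Longrightarrow> e \<in> N \<Longrightarrow> field_in_chart N Z e (coords e q) = coord_change d e q (\<zeta> (coords d q))"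
      using r q d chart_at by (auto simp: field_in_chart_def coord_change_compose)
  qed
  have \<zeta>p: "\<zeta> (coords d p) = s"
    using p d Zp chart_at by (simp add: \<zeta>_def field_in_chart_def coord_change_inverse)
  have y0: "y 0 = coords d p" by (simp add: y_def)
  have yd: "(y has_vector_derivative s) (at 0)" unfolding y_def by (rule has_vector_derivative_line)
  have yS: "y t \<in> S" for t
    using mem_iff_slice[OF p(2)] p(1) s S by (auto simp: y_def intro: subspace_add subspace_scale)
  have near: "\<forall>\<^sub>F t in nhds 0. y t \<in> ?O \<inter> ?W"
    unfolding y_def by (rule eventually_line_in_open) (use \<tau> W p c U in auto)
  have pt: "point d (y t) \<in> M \<inter> U" "point d (y t) \<in> dom_chart d" "point d (y t) \<in> dom_chart c" "coords d (point d (y t)) = y t"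
    if t: "y t \<in> ?O \<inter> ?W" for t
  proof -
    obtain q q' where "y t = coords d q" "q \<in> dom_chart d" "q \<in> dom_chart c"
        "y t = coords d q'" "q' \<in> dom_chart d" "q' \<in> U"
      using t by auto
    moreover from this have "q = q'" using point_coords[OF d] by metis
    ultimately show "point d (y t) \<in> M \<inter> U" "point d (y t) \<in> dom_chart d" "point d (y t) \<in> dom_chart c" "coords d (point d (y t)) = y t"
      using d yS[of t] mem_iff_slice[of q] by auto
  qed
  have "\<exists>\<zeta>'. ((\<lambda>t. \<zeta> (y t)) has_vector_derivative \<zeta>') (at 0)"
    using has_vector_derivative_along_curve[OF smooth_on_has_derivative[OF \<zeta>] yd] p U by (auto simp: y0)
  then obtain \<zeta>' where \<zeta>': "((\<lambda>t. \<zeta> (y t)) has_vector_derivative \<zeta>') (at 0)" by blast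
  have "\<forall>\<^sub>F t in nhds 0. \<zeta> (y t) \<in> S"
    using near by eventually_elim (metis pt(1,2,4) \<zeta>S(1))
  then have \<zeta>'S: "\<zeta>' \<in> S" by (rule vector_derivative_in_subspace[OF \<zeta>' S])
  have pO: "coords d p \<in> ?O" using p c by blast
  have A: "((\<lambda>t. dderiv \<tau> (\<zeta> (y t)) (y t)) has_vector_derivative
      dderiv (dderiv \<tau> s) s (coords d p) + dderiv \<tau> \<zeta>' (coords d p)) (at 0)"
    using has_vector_derivative_dderiv_along[OF \<tau>(2,1) _ yd \<zeta>'] pO by (simp add: y0 \<zeta>p)
  have "\<forall>\<^sub>F t in nhds 0. dderiv \<tau> (\<zeta> (y t)) (y t) = field_in_chart N Z c (\<tau> (y t))"
    using near
  proof eventually_elim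
    case (elim t)
    show ?case using \<zeta>S(2)[OF pt(1,2)[OF elim] pt(3)[OF elim] c(1)] pt(4)[OF elim]
      by (simp add: coord_change_eq_dderiv \<tau>_def)
  qed
  note A' = has_vector_derivative_eventually_eq[OF A this]
  have \<tau>p: "\<tau> (y 0) = coords c p" using p d by (simp add: \<tau>_def y0)
  have \<tau>d: "((\<lambda>t. \<tau> (y t)) has_vector_derivative X) (at 0)"
    using has_vector_derivative_along_curve[of \<tau> "coord_change d c p" y 0 s] coord_change_has_derivative[OF d c(1) p(2) c(2)] yd
    by (simp add: X_def \<tau>_def y0)
  have "smooth_on (coords c ` (U \<inter> dom_chart c)) (field_in_chart N Z c)"
    using Z(1) c by (simp add: smooth_field_def)
  from smooth_on_has_derivative[OF this]
  have "(field_in_chart N Z c has_derivative frechet_derivative (field_in_chart N Z c) (at (coords c p))) (at (\<tau> (y 0)))"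
    using U c by (auto simp: \<tau>p)
  from has_vector_derivative_along_curve[of _ _ "\<lambda>t. \<tau> (y t)", OF this \<tau>d] A'
  have "frechet_derivative (field_in_chart N Z c) (at (coords c p)) X
     = dderiv (dderiv \<tau> s) s (coords d p) + dderiv \<tau> \<zeta>' (coords d p)"
    using vector_derivative_unique_at by blast
  then have "cov_deriv N g p X Z - slice_acceleration p s = coord_change d c p \<zeta>'"
    using Zp by (simp add: cov_deriv_def slice_acceleration_def Let_def c_def[symmetric] X_def \<tau>_def coord_change_eq_dderiv)
  then show ?thesis using \<zeta>'S tangent_space_eq[OF p] by (auto simp: X_def c_def)
qed

text \<open>The second fundamental form and the slice acceleration differ by a tangent vector, to which the mean
  curvature vector is orthogonal.\<close>
lemma Omega_eq:
  assumes p: "p \<in> M" "p \<in> dom_chart d" and s: "s \<in> S"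
  defines "X \<equiv> coord_change d (chart_at N p) p s"
  shows "Omega N g M p X X = g p (mean_curvature N g M p) (slice_acceleration p s)"
proof -
  let ?P = "\<lambda>Z. \<exists>U. open U \<and> p \<in> U \<and> smooth_field N U Z \<and>
          (\<forall>q\<in>M \<inter> U. Z q \<in> tangent_space N M q) \<and> Z p = X"
  define Z where "Z = (SOME Z. ?P Z)"
  have "?P (\<lambda>q. coord_change d (chart_at N q) q s)"
    using constant_slice_field[OF s] open_dom[OF d] p(2) unfolding X_def by blast
  then have "?P Z" unfolding Z_def by (rule someI[of ?P])
  then obtain U where U: "open U" "p \<in> U" "smooth_field N U Z" "\<And>q. q\<in>M \<inter> U \<Longrightarrow> Z q \<in> tangent_space N M q" "Z p = X"
    by blast
  define h where "h = second_fundamental_form N g M p X X"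
  have h: "h = normal_part N g M p (cov_deriv N g p X Z)" by (simp add: h_def second_fundamental_form_def Z_def)
  note sub = subspace_tangent_space[OF p]
  have "cov_deriv N g p X Z - slice_acceleration p s \<in> tangent_space N M p"
    using cov_deriv_tangent_field[OF p s U(1-4)] U(5) by (simp add: X_def)
  moreover have "cov_deriv N g p X Z - h \<in> tangent_space N M p"
    unfolding h by (rule normal_part(2)[OF p])
  ultimately have "(cov_deriv N g p X Z - slice_acceleration p s) - (cov_deriv N g p X Z - h) \<in> tangent_space N M p"
    using subspace_diff[OF sub] by blast
  then have "g p (mean_curvature N g M p) (h - slice_acceleration p s) = 0"
    by (intro mean_curvature_normal[OF p]) simp
  moreover have "linear (g p (mean_curvature N g M p))" using metric(1)[of p] by (auto simp: bilinear_def)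
  ultimately show ?thesis
    unfolding Omega_def h_def[symmetric] by (simp add: linear_diff metric(2)[of p h])
qed

end

section \<open>The second derivative test on a subspace\<close>

text \<open>The Hessian is positive on \<open>S\<close> at all points close to \<open>y0\<close>, so along a segment from \<open>y0\<close> in a
  direction of \<open>S\<close> the derivative of \<open>f\<close>, which starts at \<open>0\<close>, increases, and then so does \<open>f\<close>.\<close>
lemma strict_local_min_on_subspace:
  fixes f :: "'e::euclidean_space \<Rightarrow> real"
  assumes "open W" "smooth_on W f" "y0 \<in> W" "subspace S"
    and f0: "f y0 = 0" and f1: "\<And>s. s \<in> S \<Longrightarrow> dderiv f s y0 = 0"
    and f2: "\<And>s. s \<in> S \<Longrightarrow> s \<noteq> 0 \<Longrightarrow> dderiv (dderiv f s) s y0 > 0"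
  shows "\<forall>\<^sub>F y in nhds y0. y - y0 \<in> S \<longrightarrow> y \<noteq> y0 \<longrightarrow> f y > 0"
proof -
  define k where "k a b y = dderiv (dderiv f a) b y" for a b y
  have sm: "smooth_on W (dderiv f a)" "smooth_on W (k a b)" for a b
    using smooth_onD(2)[OF assms(2), of a] smooth_onD(2)[OF smooth_onD(2)[OF assms(2), of a], of b]
    by (simp_all add: k_def[abs_def])
  have q: "dderiv (dderiv f s) s y = quad_form (\<lambda>a b. k a b y) s s" if "y \<in> W" for s y
  proof -
    have "dderiv (dderiv f s) s y = (\<Sum>a\<in>Basis. (s \<bullet> a) *\<^sub>R k a s y)"
      unfolding k_def by (rule dderiv_dderiv_linear[OF assms(1,2) that])
    also have "\<dots> = (\<Sum>a\<in>Basis. (s \<bullet> a) *\<^sub>R (\<Sum>b\<in>Basis. (s \<bullet> b) *\<^sub>R k a b y))"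
      unfolding k_def
      by (intro sum.cong refl arg_cong2[where f = scaleR] linear_Basis_sum[OF linear_dderiv[OF smooth_onD(1)[OF sm(1) that]]])
    finally show ?thesis by (simp add: quad_form_def sum_distrib_left mult.assoc)
  qed
  have "\<exists>m>0. \<forall>\<^sub>F y in nhds y0. \<forall>s\<in>S. quad_form (\<lambda>a b. k a b y) s s \<ge> m * (norm s)\<^sup>2"
  proof (rule locally_coercive[OF _ assms(4)])
    show "isCont (k a b) y0" for a b
      using smooth_onD(3)[OF sm(2)] assms(3) by (simp only: continuous_on_eq_continuous_at[OF assms(1)])
    show "quad_form (\<lambda>a b. k a b y0) s s > 0" if "s \<in> S" "s \<noteq> 0" for s
      using f2[OF that] q[OF assms(3)] by simp
  qed
  then obtain m where m: "m > 0" "\<forall>\<^sub>F y in nhds y0. \<forall>s\<in>S. quad_form (\<lambda>a b. k a b y) s s \<ge> m * (norm s)\<^sup>2" by blast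
  from m(2) eventually_nhds_in_open[OF assms(1,3)]
  have "\<forall>\<^sub>F y in nhds y0. y \<in> W \<and> (\<forall>s\<in>S. quad_form (\<lambda>a b. k a b y) s s \<ge> m * (norm s)\<^sup>2)"
    by eventually_elim auto
  then obtain r where r: "r > 0" "\<And>y. dist y y0 < r \<Longrightarrow> y \<in> W \<and> (\<forall>s\<in>S. quad_form (\<lambda>a b. k a b y) s s \<ge> m * (norm s)\<^sup>2)"
    unfolding eventually_nhds_metric by blast
  have "f y > 0" if y: "dist y y0 < r" "y - y0 \<in> S" "y \<noteq> y0" for y
  proof -
    define s where "s = y - y0"
    have s: "s \<in> S" "s \<noteq> 0" using y by (auto simp: s_def)
    define l where "l t = y0 + t *\<^sub>R s" for t
    have l: "l t \<in> W" "dderiv (dderiv f s) s (l t) > 0" if "0 \<le> t" "t \<le> 1" for t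
    proof -
      have "dist (l t) y0 = t * dist y y0" using that by (simp add: l_def s_def dist_norm)
      also have "\<dots> \<le> dist y y0" using that by (simp add: mult_left_le_one_le)
      finally have t: "dist (l t) y0 < r" using y by simp
      then show W: "l t \<in> W" using r by blast
      have "0 < m * (norm s)\<^sup>2" using m s by simp
      also have "\<dots> \<le> dderiv (dderiv f s) s (l t)" using r(2)[OF t] s q[OF W] by simp
      finally show "dderiv (dderiv f s) s (l t) > 0" .
    qed
    have ld: "(l has_vector_derivative s) (at t)" for t
      unfolding l_def by (rule has_vector_derivative_line)
    have d1: "((\<lambda>t. f (l t)) has_real_derivative dderiv f s (l t)) (at t)"
      and d2: "((\<lambda>t. dderiv f s (l t)) has_real_derivative dderiv (dderiv f s) s (l t)) (at t)"
      if "0 \<le> t" "t \<le> 1" for t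
      unfolding has_real_derivative_iff_has_vector_derivative
      by (rule has_vector_derivative_along_curve[OF smooth_on_has_derivative ld];
          use assms(2) sm(1) l(1)[OF that] in blast)+
    have pos: "dderiv f s (l t) > 0" if "0 < t" "t \<le> 1" for t
    proof -
      have "dderiv f s (l 0) < dderiv f s (l t)"
        using that by (intro DERIV_pos_imp_increasing[of 0 t "\<lambda>t. dderiv f s (l t)"]) (auto intro!: exI d2 l)
      then show ?thesis using f1[OF s(1)] by (simp add: l_def)
    qed
    have "f (l 0) < f (l 1)"
    proof (rule DERIV_pos_imp_increasing_open[where f = "\<lambda>t. f (l t)"])
      show "\<exists>z. ((\<lambda>t. f (l t)) has_real_derivative z) (at t) \<and> z > 0" if "0 < t" "t < 1" for t
        using d1[of t] pos[of t] that by auto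
      show "continuous_on {0..1} (\<lambda>t. f (l t))"
        using d1 by (intro continuous_at_imp_continuous_on ballI DERIV_isCont[of _ "dderiv f s (l _)"]) (auto intro!: DERIV_isCont)
    qed simp
    then show ?thesis using f0 by (simp add: l_def s_def)
  qed
  then show ?thesis unfolding eventually_nhds_metric using r(1) by blast
qed

section \<open>The 2-jet of the inverse exponential map\<close>

locale exp_chart = riemannian +
  fixes x D V
  assumes complete: "complete_riemannian_manifold N g"
    and exp_diffeo: "exp_diffeo N g x D V"
begin

abbreviation "\<psi> \<equiv> inv_into D (riem_exp N g x)"
abbreviation "cx \<equiv> chart_at N x"

lemma geodesic_exists:
  obtains \<gamma> where "geodesic N g \<gamma>" "\<gamma> 0 = x" "velocity N \<gamma> 0 = v"
  using complete by (auto simp: complete_riemannian_manifold_def)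

lemma log_geodesic:
  assumes "geodesic N g \<gamma>" "\<gamma> 0 = x" "velocity N \<gamma> 0 = v" "t *\<^sub>R v \<in> D"
  shows "\<psi> (\<gamma> t) = t *\<^sub>R v" "\<gamma> t \<in> V"
proof -
  have b: "bij_betw (riem_exp N g x) D V" using exp_diffeo by (simp add: exp_diffeo_def)
  have e: "riem_exp N g x (t *\<^sub>R v) = \<gamma> t" using riem_exp_scaleR[OF assms(1), of t] assms by simp
  show "\<psi> (\<gamma> t) = t *\<^sub>R v"
    using bij_betw_inv_into_left[OF b assms(4)] by (simp add: e)
  show "\<gamma> t \<in> V" using bij_betwE[OF b] assms(4) e by metis
qed

lemma log_x: "\<psi> x = 0"
proof -
  obtain \<gamma> where "geodesic N g \<gamma>" "\<gamma> 0 = x" "velocity N \<gamma> 0 = 0" by (rule geodesic_exists)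
  from log_geodesic(1)[OF this, of 0] exp_diffeo this show ?thesis by (simp add: exp_diffeo_def)
qed

lemma smooth_linear_log_in_chart:
  assumes "e \<in> N" "linear L"
  shows "smooth_on (coords e ` (V \<inter> dom_chart e)) (\<lambda>y. L (\<psi> (point e y)))"
proof -
  have "smooth_on (coords e ` (V \<inter> dom_chart e)) (\<lambda>y. \<psi> (point e y))"
    using exp_diffeo assms by (simp add: exp_diffeo_def smooth_from_def o_def)
  moreover have "open (coords e ` (V \<inter> dom_chart e))"
    using exp_diffeo assms by (intro open_coords_image) (auto simp: exp_diffeo_def)
  ultimately show ?thesis
    using smooth_on_bounded_linear_comp linear_conv_bounded_linear assms(2) by blast
qed

text \<open>Differentiate \<open>f(\<gamma>(t)) = t L(v)\<close> twice along geodesics. The first derivative, being \<open>L\<close> in every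
  direction, also evaluates the term \<open>df(\<gamma>'') = - df(\<Gamma>(v,v))\<close> of the second one.\<close>
lemma dderiv_linear_log:
  fixes L :: "'b \<Rightarrow> real"
  assumes L: "linear L"
  defines "f \<equiv> \<lambda>y. L (\<psi> (point cx y))"
  shows "dderiv f v (coords cx x) = L v"
    "dderiv (dderiv f v) v (coords cx x) = L (christoffel N g cx (coords cx x) v v)"
proof -
  have cx: "cx \<in> N" "x \<in> dom_chart cx" using chart_at by auto
  have V: "open V" "x \<in> V" and D: "open D" "0 \<in> D" using exp_diffeo by (auto simp: exp_diffeo_def)
  let ?W = "coords cx ` (V \<inter> dom_chart cx)"
  have W: "open ?W" by (rule open_coords_image[OF cx(1) V(1)])
  have f: "smooth_on ?W f" unfolding f_def by (rule smooth_linear_log_in_chart[OF cx(1) L])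
  have xW: "coords cx x \<in> ?W" using cx V by blast
  have main: "dderiv f v (coords cx x) = L v \<and>
    dderiv (dderiv f v) v (coords cx x) + dderiv f (- christoffel N g cx (coords cx x) v v) (coords cx x) = 0" for v
  proof -
    obtain \<gamma> where \<gamma>: "geodesic N g \<gamma>" "\<gamma> 0 = x" "velocity N \<gamma> 0 = v" by (rule geodesic_exists)
    define u where "u = (\<lambda>s. coords cx (\<gamma> s))"
    have u0: "u 0 = coords cx x" by (simp add: u_def \<gamma>)
    have sm: "smooth_into N UNIV \<gamma>" using \<gamma>(1) by (simp add: geodesic_def)
    have v: "dderiv u 1 0 = v"
      using velocity_in_chart[OF sm open_UNIV UNIV_I cx(1), of 0] \<gamma> cx by (simp add: u_def coord_change_self)
    have "\<forall>\<^sub>F t in nhds 0. 0 + t *\<^sub>R v \<in> D" by (rule eventually_line_in_open) (use D in auto)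
    moreover have "\<forall>\<^sub>F t in nhds 0. \<gamma> t \<in> dom_chart cx"
      using continuous_at_eventually_in[OF geodesic_isCont[OF \<gamma>(1)] open_dom[OF cx(1)]] cx \<gamma> by auto
    ultimately have ev: "\<forall>\<^sub>F t in nhds 0. t *\<^sub>R v \<in> D \<and> \<gamma> t \<in> dom_chart cx" by eventually_elim auto
    have fu: "t * L v = f (u t) \<and> u t \<in> ?W" if "t *\<^sub>R v \<in> D \<and> \<gamma> t \<in> dom_chart cx" for t
      using log_geodesic[OF \<gamma>, of t] that cx linear_cmul[OF L] by (auto simp: f_def u_def)
    \<comment> \<open>needed for all small \<open>t\<close>, so that it can be differentiated once more\<close>
    have one: "dderiv f (dderiv u 1 t) (u t) = L v"
      if "\<forall>\<^sub>F s in nhds t. s *\<^sub>R v \<in> D \<and> \<gamma> s \<in> dom_chart cx" for t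
    proof -
      have t: "t *\<^sub>R v \<in> D \<and> \<gamma> t \<in> dom_chart cx" by (rule eventually_nhds_x_imp_x[OF that])
      have "((\<lambda>s. f (u s)) has_vector_derivative dderiv f (dderiv u 1 t) (u t)) (at t)"
        using has_vector_derivative_along_curve[OF smooth_on_has_derivative[OF f], of u t "dderiv u 1 t"]
          fu[OF t] geodesic_in_chart(1)[OF \<gamma>(1) cx(1), of t] t by (simp add: u_def)
      moreover have "((\<lambda>s. f (u s)) has_vector_derivative L v) (at t)"
      proof (rule has_vector_derivative_eventually_eq)
        show "((\<lambda>s. s * L v) has_vector_derivative L v) (at t)"
          using has_vector_derivative_line[of 0 "L v"] by simp
        show "\<forall>\<^sub>F s in nhds t. s * L v = f (u s)" using that by eventually_elim (use fu in blast)
      qed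
      ultimately show ?thesis by (rule vector_derivative_unique_at)
    qed
    have "dderiv f v (coords cx x) = L v" using one[OF ev] by (simp add: v u0)
    moreover have "dderiv (dderiv f v) v (coords cx x) + dderiv f (- christoffel N g cx (coords cx x) v v) (coords cx x) = 0"
    proof -
      have g0: "\<gamma> 0 \<in> dom_chart cx" using \<gamma> cx by simp
      have "((\<lambda>t. dderiv f (dderiv u 1 t) (u t)) has_vector_derivative
         dderiv (dderiv f (dderiv u 1 0)) (dderiv u 1 0) (u 0) + dderiv f (- christoffel N g cx (u 0) (dderiv u 1 0) (dderiv u 1 0)) (u 0)) (at 0)"
        by (rule has_vector_derivative_dderiv_along[OF W f])
          (use geodesic_in_chart[OF \<gamma>(1) cx(1) g0] xW u0 in \<open>auto simp: u_def\<close>)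
      moreover have "((\<lambda>t. dderiv f (dderiv u 1 t) (u t)) has_vector_derivative 0) (at 0)"
      proof (rule has_vector_derivative_eventually_eq[OF has_vector_derivative_const[of "L v"]])
        show "\<forall>\<^sub>F t in nhds 0. L v = dderiv f (dderiv u 1 t) (u t)"
          using iffD2[OF eventually_eventually ev] by eventually_elim (use one in simp)
      qed
      ultimately show ?thesis using vector_derivative_unique_at unfolding v u0 by blast
    qed
    ultimately show ?thesis by blast
  qed
  show "dderiv f v (coords cx x) = L v" using main by blast
  show "dderiv (dderiv f v) v (coords cx x) = L (christoffel N g cx (coords cx x) v v)"
    using main[of v] main[of "- christoffel N g cx (coords cx x) v v"] linear_neg[OF L] by simp
qed

end

section \<open>Strict convexity\<close>

locale exp_slice = slice_chart N g M d S + exp_chart N g x D V for N g M d S x D V +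
  assumes x: "x \<in> M" "x \<in> dom_chart d"
begin

text \<open>Transport of the 2-jet to the slice chart by the chain rule: near the base point \<open>f = h \<circ> \<tau>\<close>, and
  the second derivative of \<open>h \<circ> \<tau>\<close> along a line is \<open>d\<^sup>2h(X,X) + dh(d\<^sup>2\<tau>(s,s))\<close>, in which
  \<open>d\<^sup>2h(X,X) = L(\<Gamma>(X,X))\<close>.\<close>
lemma dderiv_linear_log_slice:
  fixes L :: "'b \<Rightarrow> real"
  assumes L: "linear L" and s: "s \<in> S"
  defines "f \<equiv> \<lambda>y. L (\<psi> (point d y))"
  shows "dderiv f s (coords d x) = L (coord_change d cx x s)"
    "dderiv (dderiv f s) s (coords d x) = L (slice_acceleration x s)"
proof -
  have cx: "cx \<in> N" "x \<in> dom_chart cx" using chart_at by auto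
  have V: "open V" "x \<in> V" using exp_diffeo by (auto simp: exp_diffeo_def)
  define X where "X = coord_change d cx x s"
  define h where "h = (\<lambda>y. L (\<psi> (point cx y)))"
  define \<tau> where "\<tau> = (\<lambda>y. coords cx (point d y))"
  let ?O = "coords d ` (dom_chart d \<inter> dom_chart cx)"
  have \<tau>: "smooth_on ?O \<tau>" "open ?O" unfolding \<tau>_def using smooth_transition open_overlap cx d by auto
  let ?W = "coords d ` (V \<inter> dom_chart d)"
  have W: "open ?W" by (rule open_coords_image[OF d V(1)])
  have f: "smooth_on ?W f" unfolding f_def by (rule smooth_linear_log_in_chart[OF d L])
  let ?W' = "coords cx ` (V \<inter> dom_chart cx)"
  have W': "open ?W'" by (rule open_coords_image[OF cx(1) V(1)])
  have h: "smooth_on ?W' h" unfolding h_def by (rule smooth_linear_log_in_chart[OF cx(1) L])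
  define y where "y t = coords d x + t *\<^sub>R s" for t
  have y0: "y 0 = coords d x" by (simp add: y_def)
  have \<tau>0: "\<tau> (y 0) = coords cx x" using x d by (simp add: \<tau>_def y0)
  have yd: "(y has_vector_derivative s) (at t)" for t unfolding y_def by (rule has_vector_derivative_line)
  have near: "\<forall>\<^sub>F t in nhds 0. y t \<in> ?O \<inter> ?W"
    unfolding y_def by (rule eventually_line_in_open) (use \<tau> W x cx V in auto)
  have xO: "coords d x \<in> ?O" "coords d x \<in> ?W" "coords cx x \<in> ?W'" using x cx V by auto
  have fh: "f z = h (\<tau> z) \<and> \<tau> z \<in> ?W'" if z: "z \<in> ?O \<inter> ?W" for z
  proof -
    obtain q q' where "z = coords d q" "q \<in> dom_chart d" "q \<in> dom_chart cx"
        "z = coords d q'" "q' \<in> dom_chart d" "q' \<in> V"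
      using z by blast
    moreover from this have "q = q'" using point_coords[OF d] by metis
    ultimately show ?thesis using d cx by (auto simp: f_def h_def \<tau>_def)
  qed
  have chain: "dderiv f s z = dderiv h (dderiv \<tau> s z) (\<tau> z)" if "z \<in> ?O \<inter> ?W" for z
  proof -
    have "((\<lambda>z. h (\<tau> z)) has_derivative (\<lambda>v. dderiv h (dderiv \<tau> v z) (\<tau> z))) (at z)"
      by (rule has_derivative_compose[OF smooth_on_has_derivative[OF \<tau>(1)] smooth_on_has_derivative[OF h]])
        (use that fh in auto)
    then have "(f has_derivative (\<lambda>v. dderiv h (dderiv \<tau> v z) (\<tau> z))) (at z)"
      by (rule has_derivative_cong_open[OF _ open_Int[OF \<tau>(2) W] that]) (use fh in simp)
    then show ?thesis by (rule dderiv_eqI)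
  qed
  have X: "dderiv \<tau> s (coords d x) = X" by (simp add: X_def coord_change_eq_dderiv \<tau>_def)
  show "dderiv f s (coords d x) = L (coord_change d cx x s)"
    using chain[of "coords d x"] xO dderiv_linear_log(1)[OF L, of X] \<tau>0 y0 X
    by (simp add: h_def X_def)
  have 1: "((\<lambda>t. dderiv f s (y t)) has_vector_derivative dderiv (dderiv f s) s (coords d x)) (at 0)"
    using has_vector_derivative_along_curve[OF smooth_on_has_derivative[OF smooth_onD(2)[OF f]] yd, of 0 s] xO y0 by simp
  have w: "((\<lambda>t. dderiv \<tau> s (y t)) has_vector_derivative dderiv (dderiv \<tau> s) s (coords d x)) (at 0)"
    using has_vector_derivative_along_curve[OF smooth_on_has_derivative[OF smooth_onD(2)[OF \<tau>(1)]] yd, of 0 s] xO y0 by simp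
  have u: "((\<lambda>t. \<tau> (y t)) has_vector_derivative X) (at 0)"
    using has_vector_derivative_along_curve[OF smooth_on_has_derivative[OF \<tau>(1)] yd, of 0] xO y0 X by simp
  have "((\<lambda>t. dderiv h (dderiv \<tau> s (y t)) (\<tau> (y t))) has_vector_derivative
     dderiv (dderiv h X) X (coords cx x) + dderiv h (dderiv (dderiv \<tau> s) s (coords d x)) (coords cx x)) (at 0)"
    using has_vector_derivative_dderiv_along[OF W' h _ u w] xO \<tau>0 X y0 by simp
  then have "((\<lambda>t. dderiv f s (y t)) has_vector_derivative
     dderiv (dderiv h X) X (coords cx x) + dderiv h (dderiv (dderiv \<tau> s) s (coords d x)) (coords cx x)) (at 0)"
    by (rule has_vector_derivative_eventually_eq) (use near in \<open>eventually_elim, use chain in simp\<close>)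
  with 1 have "dderiv (dderiv f s) s (coords d x)
     = dderiv (dderiv h X) X (coords cx x) + dderiv h (dderiv (dderiv \<tau> s) s (coords d x)) (coords cx x)"
    by (rule vector_derivative_unique_at)
  also have "\<dots> = L (slice_acceleration x s)"
    using dderiv_linear_log[OF L] linear_add[OF L]
    by (simp add: h_def slice_acceleration_def Let_def X_def \<tau>_def add.commute)
  finally show "dderiv (dderiv f s) s (coords d x) = L (slice_acceleration x s)" .
qed

text \<open>The second derivative test for \<open>F\<close> in the slice chart: its first derivative along \<open>S\<close> vanishes
  since the mean curvature vector is normal, and its second derivative is \<open>\<Omega>\<^sub>x\<close>. Positivity of
  \<open>\<Omega>\<^sub>x\<close> on a nonzero vector, available as \<open>S\<close> has positive dimension, also excludes a vanishing mean
  curvature vector.\<close>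
lemma strictly_H_convex:
  assumes dim: "dim S \<ge> 1"
    and pos: "\<And>X. X \<in> tangent_space N M x \<Longrightarrow> X \<noteq> 0 \<Longrightarrow> Omega N g M x X X > 0"
  shows "strictly_H_convex_at N g M x D V"
proof -
  define H where "H = mean_curvature N g M x"
  define L where "L = g x H"
  have L: "linear L" using metric(1)[of x] by (auto simp: L_def bilinear_def)
  have V: "open V" "x \<in> V" using exp_diffeo by (auto simp: exp_diffeo_def)
  have cx: "cx \<in> N" "x \<in> dom_chart cx" using chart_at by auto
  have T: "coord_change d cx x s \<in> tangent_space N M x" if "s \<in> S" for s
    using that tangent_space_eq[OF x] by blast
  have T0: "coord_change d cx x s \<noteq> 0" if "s \<noteq> 0" for s
    using linear_injective_0[OF linear_coord_change[OF d cx(1) x(2) cx(2)]] inj_coord_change[OF d cx(1) x(2) cx(2)] that by blast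
  have acc: "L (slice_acceleration x s) > 0" if "s \<in> S" "s \<noteq> 0" for s
    using Omega_eq[OF x that(1)] pos[OF T[OF that(1)] T0[OF that(2)]] by (simp add: L_def H_def)
  have H0: "H \<noteq> 0"
  proof
    assume "H = 0"
    then have "L v = 0" for v
      using metric(1)[of x] by (simp add: L_def bilinear_lzero)
    moreover obtain s where "s \<in> S" "s \<noteq> 0"
      using dim by (metis dim_eq_0 not_one_le_zero subset_eq singletonI)
    ultimately show False using acc by (metis less_irrefl)
  qed
  define f where "f = (\<lambda>y. L (\<psi> (point d y)))"
  let ?W = "coords d ` (V \<inter> dom_chart d)"
  have W: "open ?W" by (rule open_coords_image[OF d V(1)])
  have f: "smooth_on ?W f" unfolding f_def by (rule smooth_linear_log_in_chart[OF d L])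
  have xW: "coords d x \<in> ?W" using x V by blast
  have "\<forall>\<^sub>F y in nhds (coords d x). y - coords d x \<in> S \<longrightarrow> y \<noteq> coords d x \<longrightarrow> f y > 0"
  proof (rule strict_local_min_on_subspace[OF W f xW S])
    show "f (coords d x) = 0" using x d log_x linear_0[OF L] by (simp add: f_def)
    show "dderiv f s (coords d x) = 0" if "s \<in> S" for s
      using dderiv_linear_log_slice(1)[OF L that] mean_curvature_normal[OF x T[OF that]]
      by (simp add: f_def L_def H_def)
    show "dderiv (dderiv f s) s (coords d x) > 0" if "s \<in> S" "s \<noteq> 0" for s
      using dderiv_linear_log_slice(2)[OF L that(1)] acc[OF that] by (simp add: f_def)
  qed
  then obtain B where B: "open B" "coords d x \<in> B"
    "\<And>y. y \<in> B \<Longrightarrow> y - coords d x \<in> S \<Longrightarrow> y \<noteq> coords d x \<Longrightarrow> f y > 0"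
    unfolding eventually_nhds by blast
  define U where "U = V \<inter> (dom_chart d \<inter> coords d -` B)"
  have "open (dom_chart d \<inter> coords d -` B)"
    using continuous_on_open_vimage[OF open_dom[OF d], of "coords d"] homeomorphism_cont1[OF chart_homeomorphism[OF d]] B(1)
    by (metis inf_commute)
  then have U: "open U" "x \<in> U" "U \<subseteq> V" using V x B by (auto simp: U_def)
  have F: "TGH_fun N g M x D p = f (coords d p)" if "p \<in> U" for p
    using that d by (simp add: TGH_fun_def f_def L_def H_def U_def)
  have Fpos: "TGH_fun N g M x D p > 0" if p: "p \<in> M \<inter> U" "p \<noteq> x" for p
  proof -
    have pd: "p \<in> dom_chart d" "coords d p \<in> B" using p by (auto simp: U_def)
    have "coords d p - coords d x \<in> S"
      using mem_iff_slice p pd x S by (auto intro: subspace_diff)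
    moreover have "coords d p \<noteq> coords d x" using point_coords[OF d] pd x p by metis
    ultimately show ?thesis using B(3) pd F p by auto
  qed
  have Fx: "TGH_fun N g M x D x = 0"
    using log_x linear_0[OF L] by (simp add: TGH_fun_def L_def H_def)
  have "M \<inter> U \<subseteq> TGH_plus N g M x D V"
    using U(3) Fpos Fx by (force simp: TGH_plus_def)
  then have "H_convex_witness N g M x D V U" using U by (simp add: H_convex_witness_def)
  moreover have "M \<inter> U \<inter> TGH N g M x D V = {x}"
    using U x(1) Fpos Fx by (force simp: TGH_def)
  ultimately show ?thesis using H0 by (auto simp: strictly_H_convex_at_def H_def)
qed

end

theorem theorem2p2:
  fixes N :: "('p::{t2_space, second_countable_topology}, 'e::euclidean_space) chart set"
    and g :: "'p \<Rightarrow> 'e \<Rightarrow> 'e \<Rightarrow> real"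
    and M :: "'p set" and n :: nat and x :: 'p
  assumes "complete_riemannian_manifold N g"
    and "n \<ge> 1" and "embedded_submanifold N M n" and "x \<in> M"
    and "\<And>X. X \<in> tangent_space N M x \<Longrightarrow> X \<noteq> 0 \<Longrightarrow> Omega N g M x X X > 0"
  shows "\<forall>D V. exp_diffeo N g x D V \<longrightarrow> strictly_H_convex_at N g M x D V"
proof (intro allI impI)
  fix D V assume exp: "exp_diffeo N g x D V"
  obtain d S where dS: "d \<in> N" "x \<in> dom_chart d" "subspace S" "dim S = n"
    "coords d ` (M \<inter> dom_chart d) = coords d ` dom_chart d \<inter> S"
    using assms(3,4) unfolding embedded_submanifold_def by blast
  have "riemannian_manifold N g" using assms(1) by (simp add: complete_riemannian_manifold_def)
  then interpret exp_slice N g M d S x D V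
    by unfold_locales (use dS assms exp in \<open>simp_all add: riemannian_manifold_def\<close>)
  show "strictly_H_convex_at N g M x D V"
    using strictly_H_convex assms(2,5) dS(4) by simp
qed

end
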